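(* Let $\mathcal C$ and $\mathcal M$ be pivotal tensor categories, let $\Phi^{\mathcal Z}:\mathcal C\to\mathcal Z(\mathcal M)$ be a pivotal functor, and let $\mathrm{Tr}_{\mathcal C}:\mathcal M\to\mathcal C$ be the right adjoint of $\Phi=F\circ\Phi^{\mathcal Z}$, where $F:\mathcal Z(\mathcal M)\to\mathcal M$ is the forgetful functor. If $A$ and $B$ are algebra objects in $\mathcal M$, then $\mathrm{Tr}_{\mathcal C}(A\otimes B)$ is an algebra object in $\mathcal C$.
   Context: Tensor functors are strong monoidal; associators and unitors are suppressed. Rigid: every object $a$ has a dual $a^*$ with $\mathrm{ev}_a:a^*\otimes a\to1$, $\mathrm{coev}_a:1\to a\otimes a^*$ satisfying the zig-zag equations, and every object is isomorphic to the dual of some object. Pivotal category: a rigid tensor category with a monoidal natural isomorphism $\varphi_a:a\to a^{**}$. A tensor functor $G$ between pivotal categories has canonical isomorphisms $\delta_x:G(x^* )\to G(x)^*$; it is a pivotal functor if $G(\varphi_x)=\delta_{x^*}^{-1}\circ\delta_x^*\circ\varphi_{G(x)}$. The Drinfel'd center $\mathcal Z(\mathcal M)$ has as objects pairs $(a,e_a)$ with $e_{a,b}:a\otimes b\to b\otimes a$ isomorphisms natural in $b$ satisfying $e_{a,b\otimes c}=(\mathrm{id}_b\otimes e_{a,c})\circ(e_{a,b}\otimes\mathrm{id}_c)$; morphisms are morphisms of $\mathcal M$ commuting with the half-braidings; the tensor product has half-braiding $e_{a\otimes b,c}=(e_{a,c}\otimes\mathrm{id}_b)\circ(\mathrm{id}_a\otimes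 e_{b,c})$; it is pivotal with the same $\varphi_a$. The forgetful functor sends $(a,e_a)$ to $a$. An algebra object in a tensor category is a triple $(A,m:A\otimes A\to A,i:1\to A)$ satisfying associativity $m\circ(m\otimes\mathrm{id}_A)=m\circ(\mathrm{id}_A\otimes m)$ and unitality $m\circ(i\otimes\mathrm{id}_A)=\mathrm{id}_A=m\circ(\mathrm{id}_A\otimes i)$. *)

theory Defs
  imports "HOL-Library.FuncSet"
begin

section \<open>Categories\<close>

record ('o, 'm) category =
  Ob    :: "'o set"
  Hom   :: "'o \<Rightarrow> 'o \<Rightarrow> 'm set"
  Comp  :: "'m \<Rightarrow> 'm \<Rightarrow> 'm"  (infixl "\<cdot>\<index>" 55)
  ident :: "'o \<Rightarrow> 'm"  ("\<I>\<index>")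

locale category =
  fixes C :: "('o, 'm, 'x) category_scheme" (structure)
  assumes Hom_Ob: "f \<in> Hom C a b \<Longrightarrow> a \<in> Ob C \<and> b \<in> Ob C"
    and Hom_disjoint: "f \<in> Hom C a b \<Longrightarrow> f \<in> Hom C a' b' \<Longrightarrow> a = a' \<and> b = b'"
    and ident_Hom: "a \<in> Ob C \<Longrightarrow> \<I> a \<in> Hom C a a"
    and Comp_Hom: "f \<in> Hom C a b \<Longrightarrow> g \<in> Hom C b c \<Longrightarrow> g \<cdot> f \<in> Hom C a c"
    and Comp_ident_left: "f \<in> Hom C a b \<Longrightarrow> \<I> b \<cdot> f = f"
    and Comp_ident_right: "f \<in> Hom C a b \<Longrightarrow> f \<cdot> \<I> a = f"
    and Comp_assoc: "f \<in> Hom C a b \<Longrightarrow> g \<in> Hom C b c \<Longrightarrow> h \<in> Hom C c d \<Longrightarrow>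
                       (h \<cdot> g) \<cdot> f = h \<cdot> (g \<cdot> f)"

context
  fixes C :: "('o, 'm, 'x) category_scheme" (structure)
begin

definition is_iso :: "'o \<Rightarrow> 'o \<Rightarrow> 'm \<Rightarrow> bool" where
  "is_iso a b f \<longleftrightarrow>
     f \<in> Hom C a b \<and> (\<exists>g\<in>Hom C b a. g \<cdot> f = \<I> a \<and> f \<cdot> g = \<I> b)"

definition inv_mor :: "'o \<Rightarrow> 'o \<Rightarrow> 'm \<Rightarrow> 'm" where
  "inv_mor a b f = (THE g. g \<in> Hom C b a \<and> g \<cdot> f = \<I> a \<and> f \<cdot> g = \<I> b)"

definition isomorphic :: "'o \<Rightarrow> 'o \<Rightarrow> bool" where
  "isomorphic a b \<longleftrightarrow> (\<exists>f. is_iso a b f)"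

end

section \<open>Functors, natural transformations, adjunctions\<close>

record ('o, 'm, 'p, 'n) cat_functor =
  fun_ob  :: "'o \<Rightarrow> 'p"
  fun_mor :: "'m \<Rightarrow> 'n"

definition is_functor ::
  "('o, 'm, 'x) category_scheme \<Rightarrow> ('p, 'n, 'y) category_scheme \<Rightarrow>
   ('o, 'm, 'p, 'n, 'z) cat_functor_scheme \<Rightarrow> bool" where
  "is_functor C D F \<longleftrightarrow>
     (\<forall>a\<in>Ob C. fun_ob F a \<in> Ob D) \<and>
     (\<forall>a b. \<forall>f\<in>Hom C a b. fun_mor F f \<in> Hom D (fun_ob F a) (fun_ob F b)) \<and>
     (\<forall>a\<in>Ob C. fun_mor F (\<I>\<^bsub>C\<^esub> a) = \<I>\<^bsub>D\<^esub> (fun_ob F a)) \<and>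
     (\<forall>a b c. \<forall>f\<in>Hom C a b. \<forall>g\<in>Hom C b c.
        fun_mor F (g \<cdot>\<^bsub>C\<^esub> f) = fun_mor F g \<cdot>\<^bsub>D\<^esub> fun_mor F f)"

definition comp_functor ::
  "('p, 'n, 'q, 'k, 'y) cat_functor_scheme \<Rightarrow> ('o, 'm, 'p, 'n, 'x) cat_functor_scheme \<Rightarrow>
   ('o, 'm, 'q, 'k) cat_functor" where
  "comp_functor G F =
     \<lparr>fun_ob = \<lambda>a. fun_ob G (fun_ob F a), fun_mor = \<lambda>f. fun_mor G (fun_mor F f)\<rparr>"

definition ident_functor :: "('o, 'm, 'o, 'm) cat_functor" where
  "ident_functor = \<lparr>fun_ob = \<lambda>a. a, fun_mor = \<lambda>f. f\<rparr>"

definition nat_trans ::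
  "('o, 'm, 'x) category_scheme \<Rightarrow> ('p, 'n, 'y) category_scheme \<Rightarrow>
   ('o, 'm, 'p, 'n, 'z) cat_functor_scheme \<Rightarrow> ('o, 'm, 'p, 'n, 'w) cat_functor_scheme \<Rightarrow>
   ('o \<Rightarrow> 'n) \<Rightarrow> bool" where
  "nat_trans C D F G t \<longleftrightarrow>
     (\<forall>a\<in>Ob C. t a \<in> Hom D (fun_ob F a) (fun_ob G a)) \<and>
     (\<forall>a b. \<forall>f\<in>Hom C a b. t b \<cdot>\<^bsub>D\<^esub> fun_mor F f = fun_mor G f \<cdot>\<^bsub>D\<^esub> t a)"

definition right_adjoint ::
  "('o, 'm, 'x) category_scheme \<Rightarrow> ('p, 'n, 'y) category_scheme \<Rightarrow>
   ('o, 'm, 'p, 'n, 'z) cat_functor_scheme \<Rightarrow> ('p, 'n, 'o, 'm, 'w) cat_functor_scheme \<Rightarrow>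
   bool" where
  "right_adjoint C D L R \<longleftrightarrow>
     is_functor C D L \<and> is_functor D C R \<and>
     (\<exists>\<eta> \<epsilon>.
        nat_trans C C ident_functor (comp_functor R L) \<eta> \<and>
        nat_trans D D (comp_functor L R) ident_functor \<epsilon> \<and>
        (\<forall>a\<in>Ob C. \<epsilon> (fun_ob L a) \<cdot>\<^bsub>D\<^esub> fun_mor L (\<eta> a) = \<I>\<^bsub>D\<^esub> (fun_ob L a)) \<and>
        (\<forall>x\<in>Ob D. fun_mor R (\<epsilon> x) \<cdot>\<^bsub>C\<^esub> \<eta> (fun_ob R x) = \<I>\<^bsub>C\<^esub> (fun_ob R x)))"

section \<open>Tensor categories and tensor functors\<close>

text \<open>Tensor categories are not assumed strict: the associator
  \<open>assoc a b c : (a \<otimes> b) \<otimes> c \<rightarrow> a \<otimes> (b \<otimes> c)\<close> and the unitors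
  \<open>\<ll> a : \<one> \<otimes> a \<rightarrow> a\<close>, \<open>\<rr> a : a \<otimes> \<one> \<rightarrow> a\<close> are part of the data.\<close>

record ('o, 'm) tensor_category = "('o, 'm) category" +
  tensor_ob  :: "'o \<Rightarrow> 'o \<Rightarrow> 'o"  (infixr "\<otimes>\<index>" 70)
  tensor_mor :: "'m \<Rightarrow> 'm \<Rightarrow> 'm"  (infixr "\<boxtimes>\<index>" 70)
  unit_ob    :: 'o  ("\<one>\<index>")
  assoc      :: "'o \<Rightarrow> 'o \<Rightarrow> 'o \<Rightarrow> 'm"
  lunit      :: "'o \<Rightarrow> 'm"  ("\<ll>\<index>")
  runit      :: "'o \<Rightarrow> 'm"  ("\<rr>\<index>")

locale tensor_category = category C
  for C :: "('o, 'm, 'x) tensor_category_scheme" (structure) +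
  assumes unit_Ob: "\<one> \<in> Ob C"
    and tensor_Ob: "a \<in> Ob C \<Longrightarrow> b \<in> Ob C \<Longrightarrow> a \<otimes> b \<in> Ob C"
    and tensor_Hom: "f \<in> Hom C a b \<Longrightarrow> g \<in> Hom C c d \<Longrightarrow> f \<boxtimes> g \<in> Hom C (a \<otimes> c) (b \<otimes> d)"
    and tensor_ident: "a \<in> Ob C \<Longrightarrow> b \<in> Ob C \<Longrightarrow> \<I> a \<boxtimes> \<I> b = \<I> (a \<otimes> b)"
    and tensor_Comp:
      "f \<in> Hom C a b \<Longrightarrow> g \<in> Hom C b c \<Longrightarrow> f' \<in> Hom C a' b' \<Longrightarrow> g' \<in> Hom C b' c' \<Longrightarrow>
         (g \<cdot> f) \<boxtimes> (g' \<cdot> f') = (g \<boxtimes> g') \<cdot> (f \<boxtimes> f')"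
    and assoc_iso:
      "a \<in> Ob C \<Longrightarrow> b \<in> Ob C \<Longrightarrow> c \<in> Ob C \<Longrightarrow>
         is_iso C ((a \<otimes> b) \<otimes> c) (a \<otimes> (b \<otimes> c)) (assoc C a b c)"
    and lunit_iso: "a \<in> Ob C \<Longrightarrow> is_iso C (\<one> \<otimes> a) a (\<ll> a)"
    and runit_iso: "a \<in> Ob C \<Longrightarrow> is_iso C (a \<otimes> \<one>) a (\<rr> a)"
    and assoc_natural:
      "f \<in> Hom C a a' \<Longrightarrow> g \<in> Hom C b b' \<Longrightarrow> h \<in> Hom C c c' \<Longrightarrow>
         assoc C a' b' c' \<cdot> ((f \<boxtimes> g) \<boxtimes> h) = (f \<boxtimes> (g \<boxtimes> h)) \<cdot> assoc C a b c"
    and lunit_natural: "f \<in> Hom C a b \<Longrightarrow> \<ll> b \<cdot> (\<I> \<one> \<boxtimes> f) = f \<cdot> \<ll> a"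
    and runit_natural: "f \<in> Hom C a b \<Longrightarrow> \<rr> b \<cdot> (f \<boxtimes> \<I> \<one>) = f \<cdot> \<rr> a"
    and pentagon:
      "a \<in> Ob C \<Longrightarrow> b \<in> Ob C \<Longrightarrow> c \<in> Ob C \<Longrightarrow> d \<in> Ob C \<Longrightarrow>
         assoc C a b (c \<otimes> d) \<cdot> assoc C (a \<otimes> b) c d =
         (\<I> a \<boxtimes> assoc C b c d) \<cdot> assoc C a (b \<otimes> c) d \<cdot> (assoc C a b c \<boxtimes> \<I> d)"
    and triangle:
      "a \<in> Ob C \<Longrightarrow> b \<in> Ob C \<Longrightarrow> (\<I> a \<boxtimes> \<ll> b) \<cdot> assoc C a \<one> b = \<rr> a \<boxtimes> \<I> b"

definition inv_assoc :: "('o, 'm, 'x) tensor_category_scheme \<Rightarrow> 'o \<Rightarrow> 'o \<Rightarrow> 'o \<Rightarrow> 'm" where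
  "inv_assoc C a b c =
     inv_mor C ((a \<otimes>\<^bsub>C\<^esub> b) \<otimes>\<^bsub>C\<^esub> c) (a \<otimes>\<^bsub>C\<^esub> (b \<otimes>\<^bsub>C\<^esub> c)) (assoc C a b c)"

record ('o, 'm, 'p, 'n) tensor_functor = "('o, 'm, 'p, 'n) cat_functor" +
  mu   :: "'o \<Rightarrow> 'o \<Rightarrow> 'n"  \<comment> \<open>\<open>F a \<otimes> F b \<rightarrow> F (a \<otimes> b)\<close>\<close>
  iota :: 'n  \<comment> \<open>\<open>\<one> \<rightarrow> F \<one>\<close>\<close>

definition is_tensor_functor ::
  "('o, 'm, 'x) tensor_category_scheme \<Rightarrow> ('p, 'n, 'y) tensor_category_scheme \<Rightarrow>
   ('o, 'm, 'p, 'n, 'z) tensor_functor_scheme \<Rightarrow> bool" where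
  "is_tensor_functor C D F \<longleftrightarrow>
     is_functor C D F \<and>
     (\<forall>a\<in>Ob C. \<forall>b\<in>Ob C.
        is_iso D (fun_ob F a \<otimes>\<^bsub>D\<^esub> fun_ob F b) (fun_ob F (a \<otimes>\<^bsub>C\<^esub> b)) (mu F a b)) \<and>
     is_iso D \<one>\<^bsub>D\<^esub> (fun_ob F \<one>\<^bsub>C\<^esub>) (iota F) \<and>
     (\<forall>a a' b b'. \<forall>f\<in>Hom C a a'. \<forall>g\<in>Hom C b b'.
        mu F a' b' \<cdot>\<^bsub>D\<^esub> (fun_mor F f \<boxtimes>\<^bsub>D\<^esub> fun_mor F g) =
        fun_mor F (f \<boxtimes>\<^bsub>C\<^esub> g) \<cdot>\<^bsub>D\<^esub> mu F a b) \<and>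
     (\<forall>a\<in>Ob C. \<forall>b\<in>Ob C. \<forall>c\<in>Ob C.
        fun_mor F (assoc C a b c) \<cdot>\<^bsub>D\<^esub> mu F (a \<otimes>\<^bsub>C\<^esub> b) c \<cdot>\<^bsub>D\<^esub> (mu F a b \<boxtimes>\<^bsub>D\<^esub> \<I>\<^bsub>D\<^esub> (fun_ob F c)) =
        mu F a (b \<otimes>\<^bsub>C\<^esub> c) \<cdot>\<^bsub>D\<^esub> (\<I>\<^bsub>D\<^esub> (fun_ob F a) \<boxtimes>\<^bsub>D\<^esub> mu F b c) \<cdot>\<^bsub>D\<^esub>
          assoc D (fun_ob F a) (fun_ob F b) (fun_ob F c)) \<and>
     (\<forall>a\<in>Ob C.
        fun_mor F (\<ll>\<^bsub>C\<^esub> a) \<cdot>\<^bsub>D\<^esub> mu F \<one>\<^bsub>C\<^esub> a \<cdot>\<^bsub>D\<^esub> (iota F \<boxtimes>\<^bsub>D\<^esub> \<I>\<^bsub>D\<^esub> (fun_ob F a)) =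
        \<ll>\<^bsub>D\<^esub> (fun_ob F a)) \<and>
     (\<forall>a\<in>Ob C.
        fun_mor F (\<rr>\<^bsub>C\<^esub> a) \<cdot>\<^bsub>D\<^esub> mu F a \<one>\<^bsub>C\<^esub> \<cdot>\<^bsub>D\<^esub> (\<I>\<^bsub>D\<^esub> (fun_ob F a) \<boxtimes>\<^bsub>D\<^esub> iota F) =
        \<rr>\<^bsub>D\<^esub> (fun_ob F a))"

definition ident_tensor_functor ::
  "('o, 'm, 'x) tensor_category_scheme \<Rightarrow> ('o, 'm, 'o, 'm) tensor_functor" where
  "ident_tensor_functor C =
     \<lparr>fun_ob = \<lambda>a. a, fun_mor = \<lambda>f. f,
      mu = \<lambda>a b. \<I>\<^bsub>C\<^esub> (a \<otimes>\<^bsub>C\<^esub> b), iota = \<I>\<^bsub>C\<^esub> \<one>\<^bsub>C\<^esub>\<rparr>"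

definition monoidal_nat_iso ::
  "('o, 'm, 'x) tensor_category_scheme \<Rightarrow> ('p, 'n, 'y) tensor_category_scheme \<Rightarrow>
   ('o, 'm, 'p, 'n, 'z) tensor_functor_scheme \<Rightarrow> ('o, 'm, 'p, 'n, 'w) tensor_functor_scheme \<Rightarrow>
   ('o \<Rightarrow> 'n) \<Rightarrow> bool" where
  "monoidal_nat_iso C D F G t \<longleftrightarrow>
     nat_trans C D F G t \<and>
     (\<forall>a\<in>Ob C. is_iso D (fun_ob F a) (fun_ob G a) (t a)) \<and>
     (\<forall>a\<in>Ob C. \<forall>b\<in>Ob C. t (a \<otimes>\<^bsub>C\<^esub> b) \<cdot>\<^bsub>D\<^esub> mu F a b = mu G a b \<cdot>\<^bsub>D\<^esub> (t a \<boxtimes>\<^bsub>D\<^esub> t b)) \<and>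
     t \<one>\<^bsub>C\<^esub> \<cdot>\<^bsub>D\<^esub> iota F = iota G"

section \<open>Rigid and pivotal categories\<close>

record ('o, 'm) rigid_category = "('o, 'm) tensor_category" +
  dual :: "'o \<Rightarrow> 'o"
  ev   :: "'o \<Rightarrow> 'm"
  coev :: "'o \<Rightarrow> 'm"

locale rigid_category = tensor_category C
  for C :: "('o, 'm, 'x) rigid_category_scheme" (structure) +
  assumes dual_Ob: "a \<in> Ob C \<Longrightarrow> dual C a \<in> Ob C"
    and ev_Hom: "a \<in> Ob C \<Longrightarrow> ev C a \<in> Hom C (dual C a \<otimes> a) \<one>"
    and coev_Hom: "a \<in> Ob C \<Longrightarrow> coev C a \<in> Hom C \<one> (a \<otimes> dual C a)"
    and zigzag: "a \<in> Ob C \<Longrightarrow>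
      \<rr> a \<cdot> (\<I> a \<boxtimes> ev C a) \<cdot> assoc C a (dual C a) a \<cdot> (coev C a \<boxtimes> \<I> a) = \<ll> a"
    and zigzag_dual: "a \<in> Ob C \<Longrightarrow>
      \<ll> (dual C a) \<cdot> (ev C a \<boxtimes> \<I> (dual C a)) \<cdot> inv_assoc C (dual C a) a (dual C a) \<cdot>
        (\<I> (dual C a) \<boxtimes> coev C a) = \<rr> (dual C a)"
    and dual_ess_surj: "a \<in> Ob C \<Longrightarrow> \<exists>b\<in>Ob C. isomorphic C a (dual C b)"

context
  fixes C :: "('o, 'm, 'x) rigid_category_scheme" (structure)
begin

text \<open>The morphism \<open>y \<rightarrow> b \<otimes> x\<^sup>*\<close> corresponding to \<open>p : y \<otimes> x \<rightarrow> b\<close>.\<close>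

definition bend :: "'o \<Rightarrow> 'o \<Rightarrow> 'm \<Rightarrow> 'm" where
  "bend y x p =
     (p \<boxtimes> \<I> (dual C x)) \<cdot> inv_assoc C y x (dual C x) \<cdot> (\<I> y \<boxtimes> coev C x) \<cdot>
       inv_mor C (y \<otimes> \<one>) y (\<rr> y)"

text \<open>The morphism \<open>y \<rightarrow> x\<^sup>*\<close> induced by a pairing \<open>p : y \<otimes> x \<rightarrow> \<one>\<close>, i.e. the unique \<open>f\<close>
  with \<open>ev x \<cdot> (f \<boxtimes> \<I> x) = p\<close>. All canonical morphisms into duals arise in this way.\<close>

definition to_dual :: "'o \<Rightarrow> 'o \<Rightarrow> 'm \<Rightarrow> 'm" where
  "to_dual y x p = \<ll> (dual C x) \<cdot> bend y x p"

text \<open>The dual \<open>b\<^sup>* \<rightarrow> a\<^sup>*\<close> of \<open>f : a \<rightarrow> b\<close>.\<close>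

definition dual_mor :: "'o \<Rightarrow> 'o \<Rightarrow> 'm \<Rightarrow> 'm" where
  "dual_mor a b f = to_dual (dual C b) a (ev C b \<cdot> (\<I> (dual C b) \<boxtimes> f))"

text \<open>The canonical isomorphisms \<open>b\<^sup>* \<otimes> a\<^sup>* \<rightarrow> (a \<otimes> b)\<^sup>*\<close> and \<open>\<one> \<rightarrow> \<one>\<^sup>*\<close>.\<close>

definition dual_tensor :: "'o \<Rightarrow> 'o \<Rightarrow> 'm" where
  "dual_tensor a b =
     to_dual (dual C b \<otimes> dual C a) (a \<otimes> b)
       (ev C b \<cdot> (\<I> (dual C b) \<boxtimes> \<ll> b) \<cdot> (\<I> (dual C b) \<boxtimes> (ev C a \<boxtimes> \<I> b)) \<cdot>
        (\<I> (dual C b) \<boxtimes> inv_assoc C (dual C a) a b) \<cdot>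
        assoc C (dual C b) (dual C a) (a \<otimes> b))"

definition dual_unit :: 'm where
  "dual_unit = to_dual \<one> \<one> (\<ll> \<one>)"

text \<open>The tensorator \<open>a\<^sup>*\<^sup>* \<otimes> b\<^sup>*\<^sup>* \<rightarrow> (b\<^sup>* \<otimes> a\<^sup>*)\<^sup>* \<rightarrow> (a \<otimes> b)\<^sup>*\<^sup>*\<close> and the unit \<open>\<one> \<rightarrow> \<one>\<^sup>* \<rightarrow> \<one>\<^sup>*\<^sup>*\<close> of
  the double dual functor. Since hom-sets are disjoint, the source and target used in
  the definition of \<open>f\<^sup>*\<^sup>*\<close> are determined by \<open>f\<close>.\<close>

definition double_dual :: "('o, 'm, 'o, 'm) tensor_functor" where
  "double_dual =
     \<lparr>fun_ob = \<lambda>a. dual C (dual C a),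
      fun_mor = \<lambda>f. (THE g. \<exists>a b. f \<in> Hom C a b \<and>
                       g = dual_mor (dual C b) (dual C a) (dual_mor a b f)),
      mu = \<lambda>a b.
        inv_mor C (dual C (dual C (a \<otimes> b))) (dual C (dual C b \<otimes> dual C a))
            (dual_mor (dual C b \<otimes> dual C a) (dual C (a \<otimes> b)) (dual_tensor a b)) \<cdot>
          dual_tensor (dual C b) (dual C a),
      iota =
        inv_mor C (dual C (dual C \<one>)) (dual C \<one>) (dual_mor \<one> (dual C \<one>) dual_unit) \<cdot>
          dual_unit\<rparr>"

end

record ('o, 'm) pivotal_category = "('o, 'm) rigid_category" +
  pivot :: "'o \<Rightarrow> 'm"

locale pivotal_category = rigid_category C
  for C :: "('o, 'm, 'x) pivotal_category_scheme" (structure) +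
  assumes pivot: "monoidal_nat_iso C C (ident_tensor_functor C) (double_dual C) (pivot C)"

text \<open>The canonical isomorphism \<open>G (x\<^sup>*) \<rightarrow> (G x)\<^sup>*\<close>, induced by
  \<open>G (x\<^sup>*) \<otimes> G x \<rightarrow> G (x\<^sup>* \<otimes> x) \<rightarrow> G \<one> \<rightarrow> \<one>\<close>.\<close>

definition functor_dual ::
  "('o, 'm, 'x) rigid_category_scheme \<Rightarrow> ('p, 'n, 'y) rigid_category_scheme \<Rightarrow>
   ('o, 'm, 'p, 'n, 'z) tensor_functor_scheme \<Rightarrow> 'o \<Rightarrow> 'n" where
  "functor_dual C D G x =
     to_dual D (fun_ob G (dual C x)) (fun_ob G x)
       (inv_mor D \<one>\<^bsub>D\<^esub> (fun_ob G \<one>\<^bsub>C\<^esub>) (iota G) \<cdot>\<^bsub>D\<^esub> fun_mor G (ev C x) \<cdot>\<^bsub>D\<^esub> mu G (dual C x) x)"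

definition pivotal_functor ::
  "('o, 'm, 'x) pivotal_category_scheme \<Rightarrow> ('p, 'n, 'y) pivotal_category_scheme \<Rightarrow>
   ('o, 'm, 'p, 'n, 'z) tensor_functor_scheme \<Rightarrow> bool" where
  "pivotal_functor C D G \<longleftrightarrow>
     is_tensor_functor C D G \<and>
     (\<forall>x\<in>Ob C.
        fun_mor G (pivot C x) =
        inv_mor D (fun_ob G (dual C (dual C x))) (dual D (fun_ob G (dual C x)))
            (functor_dual C D G (dual C x)) \<cdot>\<^bsub>D\<^esub>
          dual_mor D (fun_ob G (dual C x)) (dual D (fun_ob G x)) (functor_dual C D G x) \<cdot>\<^bsub>D\<^esub>
          pivot D (fun_ob G x))"

section \<open>The Drinfel'd center\<close>

context
  fixes M :: "('o, 'm, 'x) tensor_category_scheme" (structure)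
begin

text \<open>Half-braidings are extensional functions, so that they are determined by their
  values on objects.\<close>

definition half_braiding :: "'o \<Rightarrow> ('o \<Rightarrow> 'm) \<Rightarrow> bool" where
  "half_braiding a e \<longleftrightarrow>
     e \<in> extensional (Ob M) \<and>
     (\<forall>b\<in>Ob M. is_iso M (a \<otimes> b) (b \<otimes> a) (e b)) \<and>
     (\<forall>b c. \<forall>f\<in>Hom M b c. e c \<cdot> (\<I> a \<boxtimes> f) = (f \<boxtimes> \<I> a) \<cdot> e b) \<and>
     (\<forall>b\<in>Ob M. \<forall>c\<in>Ob M.
        e (b \<otimes> c) =
        inv_assoc M b c a \<cdot> (\<I> b \<boxtimes> e c) \<cdot> assoc M b a c \<cdot> (e b \<boxtimes> \<I> c) \<cdot> inv_assoc M a b c)"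

definition center_Ob :: "('o \<times> ('o \<Rightarrow> 'm)) set" where
  "center_Ob = {(a, e). a \<in> Ob M \<and> half_braiding a e}"

text \<open>Morphisms of the center carry their source and target, so that the hom-sets are disjoint.\<close>

definition center_Hom ::
  "('o \<times> ('o \<Rightarrow> 'm)) \<Rightarrow> ('o \<times> ('o \<Rightarrow> 'm)) \<Rightarrow>
   (('o \<times> ('o \<Rightarrow> 'm)) \<times> 'm \<times> ('o \<times> ('o \<Rightarrow> 'm))) set" where
  "center_Hom X Y =
     {(X, f, Y) | f. X \<in> center_Ob \<and> Y \<in> center_Ob \<and> f \<in> Hom M (fst X) (fst Y) \<and>
        (\<forall>b\<in>Ob M. snd Y b \<cdot> (f \<boxtimes> \<I> b) = (\<I> b \<boxtimes> f) \<cdot> snd X b)}"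

definition center_tensor ::
  "('o \<times> ('o \<Rightarrow> 'm)) \<Rightarrow> ('o \<times> ('o \<Rightarrow> 'm)) \<Rightarrow> ('o \<times> ('o \<Rightarrow> 'm))" where
  "center_tensor X Y =
     (fst X \<otimes> fst Y,
      \<lambda>c\<in>Ob M. assoc M c (fst X) (fst Y) \<cdot> (snd X c \<boxtimes> \<I> (fst Y)) \<cdot>
        inv_assoc M (fst X) c (fst Y) \<cdot> (\<I> (fst X) \<boxtimes> snd Y c) \<cdot> assoc M (fst X) (fst Y) c)"

definition center_unit :: "'o \<times> ('o \<Rightarrow> 'm)" where
  "center_unit = (\<one>, \<lambda>b\<in>Ob M. inv_mor M (b \<otimes> \<one>) b (\<rr> b) \<cdot> \<ll> b)"

end

text \<open>The half-braiding \<open>a\<^sup>* \<otimes> b \<rightarrow> b \<otimes> a\<^sup>*\<close> of the dual of \<open>(a, e)\<close> is obtained from the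
  inverse of \<open>e b : a \<otimes> b \<rightarrow> b \<otimes> a\<close> by bending both strands labelled \<open>a\<close>; it is the unique
  half-braiding for which \<open>ev a\<close> and \<open>coev a\<close> are morphisms of the center.\<close>

definition center_dual ::
  "('o, 'm, 'x) rigid_category_scheme \<Rightarrow> ('o \<times> ('o \<Rightarrow> 'm)) \<Rightarrow> ('o \<times> ('o \<Rightarrow> 'm))" where
  "center_dual M X =
     (let a = fst X; e = snd X in
      (dual M a,
       \<lambda>b\<in>Ob M.
         bend M (dual M a \<otimes>\<^bsub>M\<^esub> b) a
           (\<ll>\<^bsub>M\<^esub> b \<cdot>\<^bsub>M\<^esub> (ev M a \<boxtimes>\<^bsub>M\<^esub> \<I>\<^bsub>M\<^esub> b) \<cdot>\<^bsub>M\<^esub> inv_assoc M (dual M a) a b \<cdot>\<^bsub>M\<^esub>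
            (\<I>\<^bsub>M\<^esub> (dual M a) \<boxtimes>\<^bsub>M\<^esub> inv_mor M (a \<otimes>\<^bsub>M\<^esub> b) (b \<otimes>\<^bsub>M\<^esub> a) (e b)) \<cdot>\<^bsub>M\<^esub>
            assoc M (dual M a) b a)))"

definition center ::
  "('o, 'm, 'x) pivotal_category_scheme \<Rightarrow>
   ('o \<times> ('o \<Rightarrow> 'm),
    ('o \<times> ('o \<Rightarrow> 'm)) \<times> 'm \<times> ('o \<times> ('o \<Rightarrow> 'm))) pivotal_category" where
  "center M =
     \<lparr>Ob = center_Ob M,
      Hom = center_Hom M,
      Comp = \<lambda>(Y', g, Z) (X, f, Y). (X, g \<cdot>\<^bsub>M\<^esub> f, Z),
      ident = \<lambda>X. (X, \<I>\<^bsub>M\<^esub> (fst X), X),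
      tensor_ob = center_tensor M,
      tensor_mor = \<lambda>(X, f, Y) (X', f', Y').
        (center_tensor M X X', f \<boxtimes>\<^bsub>M\<^esub> f', center_tensor M Y Y'),
      unit_ob = center_unit M,
      assoc = \<lambda>X Y Z.
        (center_tensor M (center_tensor M X Y) Z,
         assoc M (fst X) (fst Y) (fst Z),
         center_tensor M X (center_tensor M Y Z)),
      lunit = \<lambda>X. (center_tensor M (center_unit M) X, \<ll>\<^bsub>M\<^esub> (fst X), X),
      runit = \<lambda>X. (center_tensor M X (center_unit M), \<rr>\<^bsub>M\<^esub> (fst X), X),
      dual = center_dual M,
      ev = \<lambda>X. (center_tensor M (center_dual M X) X, ev M (fst X), center_unit M),
      coev = \<lambda>X. (center_unit M, coev M (fst X), center_tensor M X (center_dual M X)),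
      pivot = \<lambda>X. (X, pivot M (fst X), center_dual M (center_dual M X))\<rparr>"

definition forget ::
  "('o \<times> ('o \<Rightarrow> 'm), ('o \<times> ('o \<Rightarrow> 'm)) \<times> 'm \<times> ('o \<times> ('o \<Rightarrow> 'm)), 'o, 'm) cat_functor" where
  "forget = \<lparr>fun_ob = fst, fun_mor = \<lambda>(X, f, Y). f\<rparr>"

section \<open>Algebra objects\<close>

definition algebra_object ::
  "('o, 'm, 'x) tensor_category_scheme \<Rightarrow> 'o \<Rightarrow> 'm \<Rightarrow> 'm \<Rightarrow> bool" where
  "algebra_object C A m i \<longleftrightarrow>
     A \<in> Ob C \<and> m \<in> Hom C (A \<otimes>\<^bsub>C\<^esub> A) A \<and> i \<in> Hom C \<one>\<^bsub>C\<^esub> A \<and>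
     m \<cdot>\<^bsub>C\<^esub> (m \<boxtimes>\<^bsub>C\<^esub> \<I>\<^bsub>C\<^esub> A) = m \<cdot>\<^bsub>C\<^esub> (\<I>\<^bsub>C\<^esub> A \<boxtimes>\<^bsub>C\<^esub> m) \<cdot>\<^bsub>C\<^esub> assoc C A A A \<and>
     m \<cdot>\<^bsub>C\<^esub> (i \<boxtimes>\<^bsub>C\<^esub> \<I>\<^bsub>C\<^esub> A) = \<ll>\<^bsub>C\<^esub> A \<and>
     m \<cdot>\<^bsub>C\<^esub> (\<I>\<^bsub>C\<^esub> A \<boxtimes>\<^bsub>C\<^esub> i) = \<rr>\<^bsub>C\<^esub> A"

end

theory Submission
  imports Defs
begin

text \<open>
  Write \<open>X = A \<otimes> B\<close>, \<open>\<Phi> = F \<circ> PhiZ\<close>, and \<open>T = Tr X\<close> with counit \<open>\<epsilon> : \<Phi> T \<rightarrow> X\<close>. Given \<open>g : z \<rightarrow> X\<close> with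
  \<open>z\<close> central, the inverse half-braiding moves \<open>z\<close> past \<open>B\<close>, so that \<open>g\<close> can be inserted between
  the two factors of \<open>X\<close>; multiplying in \<open>A\<close> and \<open>B\<close> gives an action
  \<open>X \<otimes> z = A \<otimes> B \<otimes> z \<rightarrow> A \<otimes> z \<otimes> B \<rightarrow> A \<otimes> A \<otimes> B \<otimes> B \<rightarrow> X\<close>.
  The multiplication of \<open>T\<close> is adjoint to \<open>\<Phi> T \<otimes> \<Phi> T \<rightarrow> X \<otimes> \<Phi> T \<rightarrow> X\<close>, i.e. the second argument is
  nested inside the first, and the unit is adjoint to \<open>iA \<otimes> iB\<close>. Associativity of nesting is the
  hexagon together with naturality of the half-braiding in \<open>mB\<close>.
\<close>

section \<open>Coherence in tensor categories\<close>

text \<open>Total source and target functions turn typing conditions into equations which the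
  simplifier can discharge.\<close>

context category
begin

definition arr :: "'m \<Rightarrow> bool" where
  "arr f \<longleftrightarrow> (\<exists>a b. f \<in> Hom C a b)"

definition src :: "'m \<Rightarrow> 'o" where
  "src f = (THE a. \<exists>b. f \<in> Hom C a b)"

definition trg :: "'m \<Rightarrow> 'o" where
  "trg f = (THE b. \<exists>a. f \<in> Hom C a b)"

text \<open>Disjointness of the hom-sets leaves a morphism at most one source and one target, so
  both definite descriptions denote.\<close>

lemma Hom_iff: "f \<in> Hom C a b \<longleftrightarrow> arr f \<and> src f = a \<and> trg f = b"
proof -
  have *: "arr f \<and> src f = a \<and> trg f = b" if "f \<in> Hom C a b" for a b
    unfolding arr_def src_def trg_def using that by (blast dest: Hom_disjoint)
  show ?thesis
    using * by (auto simp: arr_def)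
qed

lemma arr_Ob [simp]: "arr f \<Longrightarrow> src f \<in> Ob C" "arr f \<Longrightarrow> trg f \<in> Ob C"
  using Hom_Ob[of f "src f" "trg f"] by (auto simp: Hom_iff)

lemma ident_simps [simp]:
  assumes "a \<in> Ob C"
  shows "arr (\<I> a)" "src (\<I> a) = a" "trg (\<I> a) = a"
  using ident_Hom[OF assms] by (auto simp: Hom_iff)

lemma Comp_simps [simp]:
  assumes "arr f" "arr g" "src g = trg f"
  shows "arr (g \<cdot> f)" "src (g \<cdot> f) = src f" "trg (g \<cdot> f) = trg g"
  using Comp_Hom[of f "src f" "trg f" g "trg g"] assms by (auto simp: Hom_iff)

lemma ident_left [simp]: "arr f \<Longrightarrow> trg f = b \<Longrightarrow> \<I> b \<cdot> f = f"
  using Comp_ident_left[of f "src f" b] by (auto simp: Hom_iff)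

lemma ident_right [simp]: "arr f \<Longrightarrow> src f = a \<Longrightarrow> f \<cdot> \<I> a = f"
  using Comp_ident_right[of f a "trg f"] by (auto simp: Hom_iff)

lemma comp_assoc [simp]:
  assumes "arr f" "arr g" "arr h" "src h = trg g" "src g = trg f"
  shows "(h \<cdot> g) \<cdot> f = h \<cdot> (g \<cdot> f)"
  using Comp_assoc[of f "src f" "trg f" g "trg g" h "trg h"] assms by (auto simp: Hom_iff)

text \<open>Since \<open>comp_assoc\<close> nests composites to the right, the factor
  \<open>g \<cdot> f\<close> is split up inside a longer composite; this makes an equation for it
  applicable there.\<close>

lemma comp_reduce:
  assumes "g \<cdot> f = k" "arr f" "arr g" "arr h" "src g = trg f" "src f = trg h"
  shows "g \<cdot> (f \<cdot> h) = k \<cdot> h"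
  using assms by (metis comp_assoc)

text \<open>Two-sided inverses are unique, so the definite description in \<open>inv_mor\<close>
  denotes the inverse.\<close>

lemma is_isoD:
  assumes "is_iso C a b f"
  shows "arr f" "src f = a" "trg f = b"
    "arr (inv_mor C a b f)" "src (inv_mor C a b f) = b" "trg (inv_mor C a b f) = a"
    "inv_mor C a b f \<cdot> f = \<I> a" "f \<cdot> inv_mor C a b f = \<I> b"
proof -
  obtain g where g: "g \<in> Hom C b a" "g \<cdot> f = \<I> a" "f \<cdot> g = \<I> b" and f: "f \<in> Hom C a b"
    using assms by (auto simp: is_iso_def)
  have "inv_mor C a b f = g"
    unfolding inv_mor_def
  proof (rule the_equality)
    fix h assume h: "h \<in> Hom C b a \<and> h \<cdot> f = \<I> a \<and> f \<cdot> h = \<I> b"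
    have "h = h \<cdot> (f \<cdot> g)"
      using h g by (auto simp: Hom_iff)
    also have "\<dots> = (h \<cdot> f) \<cdot> g"
      using h f g(1) comp_assoc[of g f h] by (simp add: Hom_iff)
    also have "\<dots> = g"
      using h g by (auto simp: Hom_iff)
    finally show "h = g" .
  qed (use g in blast)
  then show "arr f" "src f = a" "trg f = b"
    "arr (inv_mor C a b f)" "src (inv_mor C a b f) = b" "trg (inv_mor C a b f) = a"
    "inv_mor C a b f \<cdot> f = \<I> a" "f \<cdot> inv_mor C a b f = \<I> b"
    using f g by (auto simp: Hom_iff)
qed

lemma inv_mor_eqI:
  assumes "f \<in> Hom C a b" "g \<in> Hom C b a" "g \<cdot> f = \<I> a" "f \<cdot> g = \<I> b"
  shows "inv_mor C a b f = g"
proof -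
  have iso: "is_iso C a b f"
    using assms by (auto simp: is_iso_def)
  note f = is_isoD[OF iso]
  have "inv_mor C a b f \<cdot> (f \<cdot> g) = (inv_mor C a b f \<cdot> f) \<cdot> g"
    using f assms(1,2) comp_assoc[of g f "inv_mor C a b f"] by (simp add: Hom_iff)
  then show ?thesis
    using f assms by (auto simp: Hom_iff)
qed

lemma iso_cancel_right:
  assumes "is_iso C a b k" "arr f" "arr g" "src f = b" "src g = b" "f \<cdot> k = g \<cdot> k"
  shows "f = g"
proof -
  note k = is_isoD[OF assms(1)]
  have "f = (f \<cdot> k) \<cdot> inv_mor C a b k"
    using k assms(2-5) by simp
  also have "\<dots> = g"
    unfolding assms(6) using k assms(2-5) by simp
  finally show ?thesis .
qed

lemma iso_cancel_left:
  assumes "is_iso C a b k" "arr f" "arr g" "trg f = a" "trg g = a" "k \<cdot> f = k \<cdot> g"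
  shows "f = g"
proof -
  note k = is_isoD[OF assms(1)]
  have "f = inv_mor C a b k \<cdot> (k \<cdot> f)"
    using k assms(2-5) by (metis comp_assoc ident_left)
  also have "\<dots> = g"
    unfolding assms(6) using k assms(2-5) by (metis comp_assoc ident_left)
  finally show ?thesis .
qed

lemma is_isoI:
  assumes "f \<in> Hom C a b" "g \<in> Hom C b a" "g \<cdot> f = \<I> a" "f \<cdot> g = \<I> b"
  shows "is_iso C a b f"
  using assms by (auto simp: is_iso_def)

lemma
  assumes "is_iso C a b f" "is_iso C b c g"
  shows is_iso_comp: "is_iso C a c (g \<cdot> f)"
    and inv_mor_comp: "inv_mor C a c (g \<cdot> f) = inv_mor C a b f \<cdot> inv_mor C b c g"
proof -
  note f = is_isoD[OF assms(1)] and g = is_isoD[OF assms(2)]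
  have ob: "a \<in> Ob C" "b \<in> Ob C" "c \<in> Ob C"
    using f(1-3) g(1-3) arr_Ob by blast+
  have Hom: "g \<cdot> f \<in> Hom C a c" "inv_mor C a b f \<cdot> inv_mor C b c g \<in> Hom C c a"
    using f g by (auto simp: Hom_iff)
  have left: "(inv_mor C a b f \<cdot> inv_mor C b c g) \<cdot> (g \<cdot> f) = \<I> a"
    using f g ob by (simp add: comp_reduce[OF g(7)])
  have right: "(g \<cdot> f) \<cdot> (inv_mor C a b f \<cdot> inv_mor C b c g) = \<I> c"
    using f g ob by (simp add: comp_reduce[OF f(8)])
  show "is_iso C a c (g \<cdot> f)"
    by (rule is_isoI[OF Hom left right])
  show "inv_mor C a c (g \<cdot> f) = inv_mor C a b f \<cdot> inv_mor C b c g"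
    by (rule inv_mor_eqI[OF Hom left right])
qed

end

section \<open>Interchange, naturality and the unit coherences\<close>

context tensor_category
begin

declare unit_Ob [simp] tensor_Ob [simp]

lemma tensor_simps [simp]:
  assumes "arr f" "arr g"
  shows "arr (f \<boxtimes> g)" "src (f \<boxtimes> g) = src f \<otimes> src g" "trg (f \<boxtimes> g) = trg f \<otimes> trg g"
  using tensor_Hom[of f "src f" "trg f" g "src g" "trg g"] assms by (auto simp: Hom_iff)

declare tensor_ident [simp]

lemma interchange:
  assumes "arr f" "arr g" "arr f'" "arr g'" "src g = trg f" "src g' = trg f'"
  shows "(g \<boxtimes> g') \<cdot> (f \<boxtimes> f') = (g \<cdot> f) \<boxtimes> (g' \<cdot> f')"
  using tensor_Comp[of f "src f" "trg f" g "trg g" f' "src f'" "trg f'" g' "trg g'"] assms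
  by (auto simp: Hom_iff)

text \<open>The form for right-nested composites, where a further factor \<open>h\<close>
  follows.\<close>

lemma interchange':
  assumes "arr f" "arr g" "arr f'" "arr g'" "src g = trg f" "src g' = trg f'"
    "arr h" "trg h = src f \<otimes> src f'"
  shows "(g \<boxtimes> g') \<cdot> ((f \<boxtimes> f') \<cdot> h) = ((g \<cdot> f) \<boxtimes> (g' \<cdot> f')) \<cdot> h"
  using assms by (intro comp_reduce interchange) auto

lemmas interch = interchange interchange'

abbreviation linv ("\<ll>\<^sup>-") where "linv a \<equiv> inv_mor C (\<one> \<otimes> a) a (\<ll> a)"
abbreviation rinv ("\<rr>\<^sup>-") where "rinv a \<equiv> inv_mor C (a \<otimes> \<one>) a (\<rr> a)"
abbreviation as where "as \<equiv> assoc C"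
abbreviation ai where "ai \<equiv> inv_assoc C"

lemmas assoc_simps [simp] = assoc_iso[THEN is_isoD(1)] assoc_iso[THEN is_isoD(2)]
  assoc_iso[THEN is_isoD(3)] assoc_iso[THEN is_isoD(4), folded inv_assoc_def]
  assoc_iso[THEN is_isoD(5), folded inv_assoc_def] assoc_iso[THEN is_isoD(6), folded inv_assoc_def]
  assoc_iso[THEN is_isoD(7), folded inv_assoc_def] assoc_iso[THEN is_isoD(8), folded inv_assoc_def]

lemmas unitor_simps [simp] =
  lunit_iso[THEN is_isoD(1)] lunit_iso[THEN is_isoD(2)] lunit_iso[THEN is_isoD(3)]
  lunit_iso[THEN is_isoD(4)] lunit_iso[THEN is_isoD(5)] lunit_iso[THEN is_isoD(6)]
  lunit_iso[THEN is_isoD(7)] lunit_iso[THEN is_isoD(8)]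
  runit_iso[THEN is_isoD(1)] runit_iso[THEN is_isoD(2)] runit_iso[THEN is_isoD(3)]
  runit_iso[THEN is_isoD(4)] runit_iso[THEN is_isoD(5)] runit_iso[THEN is_isoD(6)]
  runit_iso[THEN is_isoD(7)] runit_iso[THEN is_isoD(8)]

lemmas assoc_cancel [simp] =
  comp_reduce[OF assoc_iso[THEN is_isoD(7), folded inv_assoc_def]]
  comp_reduce[OF assoc_iso[THEN is_isoD(8), folded inv_assoc_def]]

lemmas unitor_cancel [simp] =
  comp_reduce[OF lunit_iso[THEN is_isoD(7)]]
  comp_reduce[OF lunit_iso[THEN is_isoD(8)]]
  comp_reduce[OF runit_iso[THEN is_isoD(7)]]
  comp_reduce[OF runit_iso[THEN is_isoD(8)]]

lemma assoc_nat:
  assumes "arr f" "arr g" "arr h"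
    "trg f = a'" "trg g = b'" "trg h = c'"
  shows "as a' b' c' \<cdot> ((f \<boxtimes> g) \<boxtimes> h) = (f \<boxtimes> (g \<boxtimes> h)) \<cdot> as (src f) (src g) (src h)"
  using assoc_natural[of f "src f" a' g "src g" b' h "src h" c'] assms by (auto simp: Hom_iff)

lemma assoc_nat':
  assumes "arr f" "arr g" "arr h" "trg f = a'" "trg g = b'" "trg h = c'"
    "arr k" "trg k = (src f \<otimes> src g) \<otimes> src h"
  shows "as a' b' c' \<cdot> (((f \<boxtimes> g) \<boxtimes> h) \<cdot> k) = (f \<boxtimes> (g \<boxtimes> h)) \<cdot> (as (src f) (src g) (src h) \<cdot> k)"
proof -
  have "as a' b' c' \<cdot> (((f \<boxtimes> g) \<boxtimes> h) \<cdot> k) = ((f \<boxtimes> (g \<boxtimes> h)) \<cdot> as (src f) (src g) (src h)) \<cdot> k"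
    using assms by (intro comp_reduce assoc_nat) auto
  then show ?thesis
    using assms by simp
qed

lemma inv_assoc_nat:
  assumes "arr f" "arr g" "arr h" "trg f = a'" "trg g = b'" "trg h = c'"
  shows "ai a' b' c' \<cdot> (f \<boxtimes> (g \<boxtimes> h)) = ((f \<boxtimes> g) \<boxtimes> h) \<cdot> ai (src f) (src g) (src h)"
proof (rule iso_cancel_right[OF assoc_iso[of "src f" "src g" "src h"]])
  show "(ai a' b' c' \<cdot> (f \<boxtimes> g \<boxtimes> h)) \<cdot> as (src f) (src g) (src h) =
        (((f \<boxtimes> g) \<boxtimes> h) \<cdot> ai (src f) (src g) (src h)) \<cdot> as (src f) (src g) (src h)"
    using assms(1-3) by (simp add: assoc_nat[OF assms(1-3) refl refl refl, symmetric] flip: assms(4-6))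
qed (use assms in auto)

lemma lunit_nat:
  assumes "arr f" "trg f = b"
  shows "\<ll> b \<cdot> (\<I> \<one> \<boxtimes> f) = f \<cdot> \<ll> (src f)"
  using lunit_natural[of f "src f" b] assms by (auto simp: Hom_iff)

lemma runit_nat:
  assumes "arr f" "trg f = b"
  shows "\<rr> b \<cdot> (f \<boxtimes> \<I> \<one>) = f \<cdot> \<rr> (src f)"
  using runit_natural[of f "src f" b] assms by (auto simp: Hom_iff)

text \<open>Naturality of \<open>\<ll>\<close> exhibits \<open>f\<close> as a conjugate of
  \<open>\<I> \<one> \<boxtimes> f\<close> by invertible unitors. Equations may thus be proved after
  tensoring with the unit, where pentagon and triangle apply.\<close>

lemma whisker_left_faithful:
  assumes "arr f" "arr g" "src f = src g" "trg f = trg g" "\<I> \<one> \<boxtimes> f = \<I> \<one> \<boxtimes> g"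
  shows "f = g"
proof (rule iso_cancel_right[OF lunit_iso[of "src f"]])
  show "f \<cdot> \<ll> (src f) = g \<cdot> \<ll> (src f)"
    using lunit_nat[of f "trg f"] lunit_nat[of g "trg g"] assms by simp
qed (use assms in auto)

lemma whisker_right_faithful:
  assumes "arr f" "arr g" "src f = src g" "trg f = trg g" "f \<boxtimes> \<I> \<one> = g \<boxtimes> \<I> \<one>"
  shows "f = g"
proof (rule iso_cancel_right[OF runit_iso[of "src f"]])
  show "f \<cdot> \<rr> (src f) = g \<cdot> \<rr> (src f)"
    using runit_nat[of f "trg f"] runit_nat[of g "trg g"] assms by simp
qed (use assms in auto)

lemma pentagon':
  assumes "a \<in> Ob C" "b \<in> Ob C" "c \<in> Ob C" "d \<in> Ob C"
  shows "as a b (c \<otimes> d) \<cdot> as (a \<otimes> b) c d =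
         (\<I> a \<boxtimes> as b c d) \<cdot> (as a (b \<otimes> c) d \<cdot> (as a b c \<boxtimes> \<I> d))"
  using pentagon[of a b c d] assms by simp

lemma
  assumes "is_iso C a b f" "is_iso C c d g"
  shows is_iso_tensor: "is_iso C (a \<otimes> c) (b \<otimes> d) (f \<boxtimes> g)"
    and inv_mor_tensor: "inv_mor C (a \<otimes> c) (b \<otimes> d) (f \<boxtimes> g) = inv_mor C a b f \<boxtimes> inv_mor C c d g"
proof -
  note f = is_isoD[OF assms(1)] and g = is_isoD[OF assms(2)]
  have ob: "a \<in> Ob C" "b \<in> Ob C" "c \<in> Ob C" "d \<in> Ob C"
    using f(1-3) g(1-3) arr_Ob by blast+
  have Hom: "f \<boxtimes> g \<in> Hom C (a \<otimes> c) (b \<otimes> d)"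
    "inv_mor C a b f \<boxtimes> inv_mor C c d g \<in> Hom C (b \<otimes> d) (a \<otimes> c)"
    using f g by (auto simp: Hom_iff)
  have inv: "(inv_mor C a b f \<boxtimes> inv_mor C c d g) \<cdot> (f \<boxtimes> g) = \<I> (a \<otimes> c)"
    "(f \<boxtimes> g) \<cdot> (inv_mor C a b f \<boxtimes> inv_mor C c d g) = \<I> (b \<otimes> d)"
    using f g ob by (simp_all add: interch)
  show "is_iso C (a \<otimes> c) (b \<otimes> d) (f \<boxtimes> g)"
    by (rule is_isoI[OF Hom inv])
  show "inv_mor C (a \<otimes> c) (b \<otimes> d) (f \<boxtimes> g) = inv_mor C a b f \<boxtimes> inv_mor C c d g"
    by (rule inv_mor_eqI[OF Hom inv])
qed

lemma inv_mor_ident: "a \<in> Ob C \<Longrightarrow> inv_mor C a a (\<I> a) = \<I> a"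
  by (rule inv_mor_eqI) (auto simp: Hom_iff)

lemma inv_assoc_iso:
  assumes "a \<in> Ob C" "b \<in> Ob C" "c \<in> Ob C"
  shows "is_iso C (a \<otimes> (b \<otimes> c)) ((a \<otimes> b) \<otimes> c) (ai a b c)"
  by (rule is_isoI[where g = "as a b c"]) (use assms in \<open>auto simp: Hom_iff\<close>)

lemma inv_mor_inv_assoc:
  assumes "a \<in> Ob C" "b \<in> Ob C" "c \<in> Ob C"
  shows "inv_mor C (a \<otimes> (b \<otimes> c)) ((a \<otimes> b) \<otimes> c) (ai a b c) = as a b c"
  by (rule inv_mor_eqI) (use assms in \<open>auto simp: Hom_iff\<close>)

lemma is_iso_ident: "a \<in> Ob C \<Longrightarrow> is_iso C a a (\<I> a)"
  by (rule is_isoI[where g = "\<I> a"]) (auto simp: Hom_iff)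

text \<open>Kelly's argument: after tensoring with \<open>\<one>\<close> on the left and
  precomposing with the invertible \<open>?k\<close>, the pentagon at \<open>\<one>\<close>,
  \<open>\<one>\<close>, \<open>a\<close>, \<open>b\<close> and two triangles give the
  equation.\<close>

lemma lunit_tensor:
  assumes [simp]: "a \<in> Ob C" "b \<in> Ob C"
  shows "\<ll> (a \<otimes> b) \<cdot> as \<one> a b = \<ll> a \<boxtimes> \<I> b"
proof (rule whisker_left_faithful)
  let ?k = "as \<one> (\<one> \<otimes> a) b \<cdot> (as \<one> \<one> a \<boxtimes> \<I> b)"
  have iso: "is_iso C (((\<one> \<otimes> \<one>) \<otimes> a) \<otimes> b) (\<one> \<otimes> ((\<one> \<otimes> a) \<otimes> b)) ?k"
    by (rule is_iso_comp[OF is_iso_tensor[OF assoc_iso is_iso_ident] assoc_iso]) auto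
  show "\<I> \<one> \<boxtimes> (\<ll> (a \<otimes> b) \<cdot> as \<one> a b) = \<I> \<one> \<boxtimes> (\<ll> a \<boxtimes> \<I> b)"
  proof (rule iso_cancel_right[OF iso])
    have "(\<I> \<one> \<boxtimes> (\<ll> (a \<otimes> b) \<cdot> as \<one> a b)) \<cdot> ?k =
          (\<I> \<one> \<boxtimes> \<ll> (a \<otimes> b)) \<cdot> ((\<I> \<one> \<boxtimes> as \<one> a b) \<cdot> ?k)"
      by (simp add: interch)
    also have "\<dots> = (\<I> \<one> \<boxtimes> \<ll> (a \<otimes> b)) \<cdot> (as \<one> \<one> (a \<otimes> b) \<cdot> as (\<one> \<otimes> \<one>) a b)"
      by (subst pentagon') auto
    also have "\<dots> = (\<rr> \<one> \<boxtimes> (\<I> a \<boxtimes> \<I> b)) \<cdot> as (\<one> \<otimes> \<one>) a b"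
      by (simp add: comp_reduce[OF triangle])
    also have "\<dots> = as \<one> a b \<cdot> ((\<rr> \<one> \<boxtimes> \<I> a) \<boxtimes> \<I> b)"
      by (subst assoc_nat) auto
    also have "\<dots> = as \<one> a b \<cdot> ((\<I> \<one> \<boxtimes> \<ll> a) \<boxtimes> \<I> b) \<cdot> (as \<one> \<one> a \<boxtimes> \<I> b)"
      by (simp add: triangle[symmetric] interch)
    also have "\<dots> = (\<I> \<one> \<boxtimes> (\<ll> a \<boxtimes> \<I> b)) \<cdot> ?k"
      by (simp add: assoc_nat')
    finally show "(\<I> \<one> \<boxtimes> (\<ll> (a \<otimes> b) \<cdot> as \<one> a b)) \<cdot> ?k = (\<I> \<one> \<boxtimes> (\<ll> a \<boxtimes> \<I> b)) \<cdot> ?k" .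
  qed auto
qed auto

text \<open>The mirror argument, with the pentagon at \<open>a\<close>, \<open>b\<close>,
  \<open>\<one>\<close>, \<open>\<one>\<close> and an associator cancelled on the left.\<close>

lemma runit_tensor:
  assumes [simp]: "a \<in> Ob C" "b \<in> Ob C"
  shows "(\<I> a \<boxtimes> \<rr> b) \<cdot> as a b \<one> = \<rr> (a \<otimes> b)"
proof (rule whisker_right_faithful)
  show "((\<I> a \<boxtimes> \<rr> b) \<cdot> as a b \<one>) \<boxtimes> \<I> \<one> = \<rr> (a \<otimes> b) \<boxtimes> \<I> \<one>"
  proof (rule iso_cancel_left[OF assoc_iso[of a b \<one>]])
    have "as a b \<one> \<cdot> (((\<I> a \<boxtimes> \<rr> b) \<cdot> as a b \<one>) \<boxtimes> \<I> \<one>) =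
          as a b \<one> \<cdot> (((\<I> a \<boxtimes> \<rr> b) \<boxtimes> \<I> \<one>) \<cdot> (as a b \<one> \<boxtimes> \<I> \<one>))"
      by (simp add: interch)
    also have "\<dots> = (\<I> a \<boxtimes> (\<rr> b \<boxtimes> \<I> \<one>)) \<cdot> (as a (b \<otimes> \<one>) \<one> \<cdot> (as a b \<one> \<boxtimes> \<I> \<one>))"
      by (simp add: assoc_nat')
    also have "\<dots> = (\<I> a \<boxtimes> (\<I> b \<boxtimes> \<ll> \<one>)) \<cdot>
        ((\<I> a \<boxtimes> as b \<one> \<one>) \<cdot> (as a (b \<otimes> \<one>) \<one> \<cdot> (as a b \<one> \<boxtimes> \<I> \<one>)))"
      by (simp add: triangle[symmetric] interch)
    also have "\<dots> = (\<I> a \<boxtimes> (\<I> b \<boxtimes> \<ll> \<one>)) \<cdot> (as a b (\<one> \<otimes> \<one>) \<cdot> as (a \<otimes> b) \<one> \<one>)"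
      by (subst pentagon') auto
    also have "\<dots> = as a b \<one> \<cdot> (((\<I> a \<boxtimes> \<I> b) \<boxtimes> \<ll> \<one>) \<cdot> as (a \<otimes> b) \<one> \<one>)"
      by (subst assoc_nat') auto
    also have "\<dots> = as a b \<one> \<cdot> (\<rr> (a \<otimes> b) \<boxtimes> \<I> \<one>)"
      by (simp add: triangle)
    finally show "as a b \<one> \<cdot> (((\<I> a \<boxtimes> \<rr> b) \<cdot> as a b \<one>) \<boxtimes> \<I> \<one>) =
      as a b \<one> \<cdot> (\<rr> (a \<otimes> b) \<boxtimes> \<I> \<one>)" .
  qed auto
qed auto

text \<open>Naturality of \<open>\<ll>\<close> at \<open>\<ll> \<one>\<close> itself gives
  \<open>\<ll> (\<one> \<otimes> \<one>) = \<I> \<one> \<boxtimes> \<ll> \<one>\<close>; then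
  \<open>lunit_tensor\<close> and the triangle have the same left-hand side.\<close>

lemma lunit_unit: "\<ll> \<one> = \<rr> \<one>"
proof (rule whisker_right_faithful)
  have "\<ll> (\<one> \<otimes> \<one>) = \<I> \<one> \<boxtimes> \<ll> \<one>"
    by (rule iso_cancel_left[OF lunit_iso[of \<one>]]) (auto simp: lunit_nat)
  then show "\<ll> \<one> \<boxtimes> \<I> \<one> = \<rr> \<one> \<boxtimes> \<I> \<one>"
    using lunit_tensor[of \<one> \<one>] triangle[of \<one> \<one>] by simp
qed auto


text \<open>The simp rule \<open>tensor_ident\<close> fuses \<open>\<I> a \<boxtimes> \<I> b\<close>
  into one identity, after which \<open>assoc_nat\<close> no longer matches; this covers the fused
  shape.\<close>

lemma assoc_nat_ident:
  assumes "arr h" "trg h = c'" "a \<in> Ob C" "b \<in> Ob C"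
  shows "as a b c' \<cdot> (\<I> (a \<otimes> b) \<boxtimes> h) = (\<I> a \<boxtimes> (\<I> b \<boxtimes> h)) \<cdot> as a b (src h)"
  using assoc_nat[of "\<I> a" "\<I> b" h a b c'] assms by simp

lemma assoc_nat_ident':
  assumes "arr h" "trg h = c'" "a \<in> Ob C" "b \<in> Ob C" "arr k" "trg k = (a \<otimes> b) \<otimes> src h"
  shows "as a b c' \<cdot> ((\<I> (a \<otimes> b) \<boxtimes> h) \<cdot> k) = (\<I> a \<boxtimes> (\<I> b \<boxtimes> h)) \<cdot> (as a b (src h) \<cdot> k)"
  using assoc_nat'[of "\<I> a" "\<I> b" h a b c' k] assms by simp

lemma inv_assoc_nat':
  assumes "arr f" "arr g" "arr h" "trg f = a'" "trg g = b'" "trg h = c'"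
    "arr k" "trg k = src f \<otimes> (src g \<otimes> src h)"
  shows "ai a' b' c' \<cdot> ((f \<boxtimes> (g \<boxtimes> h)) \<cdot> k) = ((f \<boxtimes> g) \<boxtimes> h) \<cdot> (ai (src f) (src g) (src h) \<cdot> k)"
proof -
  have "ai a' b' c' \<cdot> ((f \<boxtimes> (g \<boxtimes> h)) \<cdot> k) = (((f \<boxtimes> g) \<boxtimes> h) \<cdot> ai (src f) (src g) (src h)) \<cdot> k"
    using assms by (intro comp_reduce inv_assoc_nat) auto
  then show ?thesis
    using assms by simp
qed

lemma inv_assoc_nat_ident:
  assumes "arr f" "trg f = a'" "b \<in> Ob C" "c \<in> Ob C"
  shows "ai a' b c \<cdot> (f \<boxtimes> \<I> (b \<otimes> c)) = ((f \<boxtimes> \<I> b) \<boxtimes> \<I> c) \<cdot> ai (src f) b c"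
  using inv_assoc_nat[of f "\<I> b" "\<I> c" a' b c] assms by simp

lemmas natural = assoc_nat assoc_nat' assoc_nat_ident assoc_nat_ident'
  inv_assoc_nat inv_assoc_nat' inv_assoc_nat_ident

text \<open>The pentagon solved for composites that mix associators and their inverses. The three
  variants fit the positions in which an \<open>ai\<close> from \<open>lact\<close> or from a
  crossing meets an \<open>as\<close>.\<close>

lemma pentagon_inv1:
  assumes [simp]: "a \<in> Ob C" "b \<in> Ob C" "c \<in> Ob C" "d \<in> Ob C"
  shows "as (a \<otimes> b) c d \<cdot> (ai a b c \<boxtimes> \<I> d) =
         ai a b (c \<otimes> d) \<cdot> ((\<I> a \<boxtimes> as b c d) \<cdot> as a (b \<otimes> c) d)"
proof -
  have "as (a \<otimes> b) c d \<cdot> (ai a b c \<boxtimes> \<I> d) =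
        ai a b (c \<otimes> d) \<cdot> ((as a b (c \<otimes> d) \<cdot> as (a \<otimes> b) c d) \<cdot> (ai a b c \<boxtimes> \<I> d))"
    by simp
  also have "\<dots> = ai a b (c \<otimes> d) \<cdot> ((\<I> a \<boxtimes> as b c d) \<cdot> as a (b \<otimes> c) d)"
    unfolding pentagon'[OF assms] by (simp add: interch)
  finally show ?thesis .
qed

lemma pentagon_inv2:
  assumes [simp]: "a \<in> Ob C" "b \<in> Ob C" "c \<in> Ob C" "d \<in> Ob C"
  shows "as a (b \<otimes> c) d \<cdot> ((as a b c \<boxtimes> \<I> d) \<cdot> ai (a \<otimes> b) c d) =
         (\<I> a \<boxtimes> ai b c d) \<cdot> as a b (c \<otimes> d)"
proof -
  have "as a (b \<otimes> c) d \<cdot> ((as a b c \<boxtimes> \<I> d) \<cdot> ai (a \<otimes> b) c d) =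
        (\<I> a \<boxtimes> ai b c d) \<cdot> (((\<I> a \<boxtimes> as b c d) \<cdot> (as a (b \<otimes> c) d \<cdot> (as a b c \<boxtimes> \<I> d))) \<cdot>
          ai (a \<otimes> b) c d)"
    by (simp add: interch)
  also have "\<dots> = (\<I> a \<boxtimes> ai b c d) \<cdot> as a b (c \<otimes> d)"
    unfolding pentagon'[OF assms, symmetric] by simp
  finally show ?thesis .
qed

lemma pentagon_inv3:
  assumes [simp]: "a \<in> Ob C" "b \<in> Ob C" "c \<in> Ob C" "d \<in> Ob C"
  shows "(as a b c \<boxtimes> \<I> d) \<cdot> ai (a \<otimes> b) c d =
         ai a (b \<otimes> c) d \<cdot> ((\<I> a \<boxtimes> ai b c d) \<cdot> as a b (c \<otimes> d))"
proof -
  have "(as a b c \<boxtimes> \<I> d) \<cdot> ai (a \<otimes> b) c d =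
        ai a (b \<otimes> c) d \<cdot> (as a (b \<otimes> c) d \<cdot> ((as a b c \<boxtimes> \<I> d) \<cdot> ai (a \<otimes> b) c d))"
    by simp
  then show ?thesis
    unfolding pentagon_inv2[OF assms] .
qed

end

section \<open>Inserting a central object between two algebras\<close>

locale algebra_pair = tensor_category C
  for C :: "('o, 'm, 'x) tensor_category_scheme" (structure) +
  fixes A B :: 'o and mA iA mB iB :: 'm
  assumes algA: "algebra_object C A mA iA"
    and algB: "algebra_object C B mB iB"
begin

lemma alg_simps [simp]:
  "A \<in> Ob C" "arr mA" "src mA = A \<otimes> A" "trg mA = A" "arr iA" "src iA = \<one>" "trg iA = A"
  "B \<in> Ob C" "arr mB" "src mB = B \<otimes> B" "trg mB = B" "arr iB" "src iB = \<one>" "trg iB = B"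
  using algA algB by (auto simp: algebra_object_def Hom_iff)

lemma alg_laws:
  "mA \<cdot> (mA \<boxtimes> \<I> A) = mA \<cdot> ((\<I> A \<boxtimes> mA) \<cdot> as A A A)"
  "mA \<cdot> (iA \<boxtimes> \<I> A) = \<ll> A" "mA \<cdot> (\<I> A \<boxtimes> iA) = \<rr> A"
  "mB \<cdot> (mB \<boxtimes> \<I> B) = mB \<cdot> ((\<I> B \<boxtimes> mB) \<cdot> as B B B)"
  "mB \<cdot> (iB \<boxtimes> \<I> B) = \<ll> B" "mB \<cdot> (\<I> B \<boxtimes> iB) = \<rr> B"
  using algA algB by (auto simp: algebra_object_def Hom_iff)

section \<open>The \<open>A\<close>-\<open>B\<close>-bimodule structure of \<open>X\<close>\<close>

abbreviation X where "X \<equiv> A \<otimes> B"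

text \<open>The regular actions on the outer factors, making \<open>X\<close> an
  \<open>A\<close>-\<open>B\<close>-bimodule; the next three laws are its associativity
  axioms.\<close>

definition lact where "lact = (mA \<boxtimes> \<I> B) \<cdot> ai A A B"
definition ract where "ract = (\<I> A \<boxtimes> mB) \<cdot> as A B B"

lemma act_simps [simp]:
  "arr lact" "src lact = A \<otimes> X" "trg lact = X"
  "arr ract" "src ract = X \<otimes> B" "trg ract = X"
  by (auto simp: lact_def ract_def)

text \<open>Associativity of \<open>mA\<close>, carried past the passive factor \<open>B\<close> by
  the pentagon.\<close>

lemma lact_assoc: "lact \<cdot> (mA \<boxtimes> \<I> X) = lact \<cdot> ((\<I> A \<boxtimes> lact) \<cdot> as A A X)"
proof -
  have "lact \<cdot> (mA \<boxtimes> \<I> X) = ((mA \<cdot> ((\<I> A \<boxtimes> mA) \<cdot> as A A A)) \<boxtimes> \<I> B) \<cdot> ai (A \<otimes> A) A B"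
    by (simp add: lact_def natural interch alg_laws)
  also have "\<dots> = ((mA \<cdot> (\<I> A \<boxtimes> mA)) \<boxtimes> \<I> B) \<cdot> ((as A A A \<boxtimes> \<I> B) \<cdot> ai (A \<otimes> A) A B)"
    by (simp add: interch)
  also have "\<dots> = (mA \<boxtimes> \<I> B) \<cdot> (((\<I> A \<boxtimes> mA) \<boxtimes> \<I> B) \<cdot> (ai A (A \<otimes> A) B \<cdot>
      ((\<I> A \<boxtimes> ai A A B) \<cdot> as A A X)))"
    by (subst pentagon_inv3) (simp_all add: interch)
  also have "\<dots> = (mA \<boxtimes> \<I> B) \<cdot> (ai A A B \<cdot> ((\<I> A \<boxtimes> (mA \<boxtimes> \<I> B)) \<cdot>
      ((\<I> A \<boxtimes> ai A A B) \<cdot> as A A X)))"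
    by (subst inv_assoc_nat') auto
  also have "\<dots> = lact \<cdot> ((\<I> A \<boxtimes> lact) \<cdot> as A A X)"
    by (simp add: lact_def interch)
  finally show ?thesis .
qed

lemma ract_assoc: "ract \<cdot> (ract \<boxtimes> \<I> B) = ract \<cdot> ((\<I> X \<boxtimes> mB) \<cdot> as X B B)"
proof -
  have "ract \<cdot> (ract \<boxtimes> \<I> B) =
      (\<I> A \<boxtimes> mB) \<cdot> (as A B B \<cdot> (((\<I> A \<boxtimes> mB) \<boxtimes> \<I> B) \<cdot> (as A B B \<boxtimes> \<I> B)))"
    by (simp add: ract_def interch)
  also have "\<dots> = (\<I> A \<boxtimes> (mB \<cdot> (mB \<boxtimes> \<I> B))) \<cdot> (as A (B \<otimes> B) B \<cdot> (as A B B \<boxtimes> \<I> B))"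
    \<comment> \<open>Naturality runs alone first: \<open>interch\<close> would merge the two
      whiskered factors and destroy the shape \<open>(f \<boxtimes> g) \<boxtimes> h\<close> that it
      needs.\<close>
    by (simp add: natural) (simp add: interch)
  also have "\<dots> = (\<I> A \<boxtimes> (mB \<cdot> (\<I> B \<boxtimes> mB))) \<cdot>
      ((\<I> A \<boxtimes> as B B B) \<cdot> (as A (B \<otimes> B) B \<cdot> (as A B B \<boxtimes> \<I> B)))"
    by (simp add: alg_laws interch)
  also have "\<dots> = (\<I> A \<boxtimes> (mB \<cdot> (\<I> B \<boxtimes> mB))) \<cdot> (as A B (B \<otimes> B) \<cdot> as X B B)"
    by (subst pentagon') auto
  also have "\<dots> = ract \<cdot> ((\<I> X \<boxtimes> mB) \<cdot> as X B B)"
    by (simp add: ract_def natural interch)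
  finally show ?thesis .
qed

text \<open>The actions touch different tensor factors, so they commute by interchange; the pentagon
  matches the bracketings.\<close>

lemma ract_lact: "ract \<cdot> (lact \<boxtimes> \<I> B) = lact \<cdot> ((\<I> A \<boxtimes> ract) \<cdot> as A X B)"
proof -
  have "ract \<cdot> (lact \<boxtimes> \<I> B) =
      (\<I> A \<boxtimes> mB) \<cdot> (as A B B \<cdot> (((mA \<boxtimes> \<I> B) \<boxtimes> \<I> B) \<cdot> (ai A A B \<boxtimes> \<I> B)))"
    by (simp add: ract_def lact_def interch)
  also have "\<dots> = (mA \<boxtimes> mB) \<cdot> (as (A \<otimes> A) B B \<cdot> (ai A A B \<boxtimes> \<I> B))"
    by (simp add: natural) (simp add: interch)
  also have "\<dots> = (mA \<boxtimes> \<I> B) \<cdot> (((\<I> A \<boxtimes> \<I> A) \<boxtimes> mB) \<cdot> (ai A A (B \<otimes> B) \<cdot>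
      ((\<I> A \<boxtimes> as A B B) \<cdot> as A X B)))"
    by (subst pentagon_inv1) (auto simp: interch)
  also have "\<dots> = (mA \<boxtimes> \<I> B) \<cdot> (ai A A B \<cdot> ((\<I> A \<boxtimes> (\<I> A \<boxtimes> mB)) \<cdot>
      ((\<I> A \<boxtimes> as A B B) \<cdot> as A X B)))"
    by (subst inv_assoc_nat') auto
  also have "\<dots> = lact \<cdot> ((\<I> A \<boxtimes> ract) \<cdot> as A X B)"
    by (simp add: ract_def lact_def interch)
  finally show ?thesis .
qed

text \<open>The properties of an inverse half-braiding \<open>s : B \<otimes> z \<rightarrow> z \<otimes> B\<close> at \<open>B\<close> on which the algebra
  laws depend: compatibility with \<open>mB\<close> and \<open>iB\<close>.\<close>

definition entwines :: "'o \<Rightarrow> 'm \<Rightarrow> bool" where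
  "entwines z s \<longleftrightarrow> z \<in> Ob C \<and> s \<in> Hom C (B \<otimes> z) (z \<otimes> B) \<and>
     s \<cdot> (mB \<boxtimes> \<I> z) =
       (\<I> z \<boxtimes> mB) \<cdot> (as z B B \<cdot> ((s \<boxtimes> \<I> B) \<cdot> (ai B z B \<cdot> ((\<I> B \<boxtimes> s) \<cdot> as B B z)))) \<and>
     s \<cdot> (iB \<boxtimes> \<I> z) = (\<I> z \<boxtimes> iB) \<cdot> (\<rr>\<^sup>- z \<cdot> \<ll> z)"

lemma entwinesD:
  assumes "entwines z s"
  shows "z \<in> Ob C" "arr s" "src s = B \<otimes> z" "trg s = z \<otimes> B"
    "s \<cdot> (mB \<boxtimes> \<I> z) =
       (\<I> z \<boxtimes> mB) \<cdot> (as z B B \<cdot> ((s \<boxtimes> \<I> B) \<cdot> (ai B z B \<cdot> ((\<I> B \<boxtimes> s) \<cdot> as B B z))))"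
    "s \<cdot> (iB \<boxtimes> \<I> z) = (\<I> z \<boxtimes> iB) \<cdot> (\<rr>\<^sup>- z \<cdot> \<ll> z)"
  using assms by (auto simp: entwines_def Hom_iff)

text \<open>\<open>act s g : X \<otimes> z \<rightarrow> X\<close> is the nesting action. Its part
  \<open>ins\<close> on \<open>B \<otimes> z\<close> is kept separate because the crossing
  \<open>s\<close> and the algebra \<open>B\<close> enter only there.\<close>

definition ins :: "'m \<Rightarrow> 'm \<Rightarrow> 'm" where
  "ins s g = ract \<cdot> ((g \<boxtimes> \<I> B) \<cdot> s)"

definition act :: "'m \<Rightarrow> 'm \<Rightarrow> 'm" where
  "act s g = lact \<cdot> ((\<I> A \<boxtimes> ins s g) \<cdot> as A B (src g))"

lemma ins_simps [simp]:
  assumes "arr s" "arr g" "src s = B \<otimes> src g" "trg s = src g \<otimes> B" "trg g = X"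
  shows "arr (ins s g)" "src (ins s g) = B \<otimes> src g" "trg (ins s g) = X"
    "arr (act s g)" "src (act s g) = X \<otimes> src g" "trg (act s g) = X"
  using assms by (auto simp: ins_def act_def)

text \<open>\<open>A\<close> enters \<open>act\<close> only through \<open>lact\<close> from the
  left, so this is \<open>lact_assoc\<close> up to bracketing.\<close>

lemma act_lact:
  assumes [simp]: "arr s" "arr g" "src s = B \<otimes> w" "trg s = w \<otimes> B" "src g = w" "trg g = X"
  shows "act s g \<cdot> (lact \<boxtimes> \<I> w) = lact \<cdot> ((\<I> A \<boxtimes> act s g) \<cdot> as A X w)"
proof -
  have [simp]: "w \<in> Ob C"
    using arr_Ob(1)[of g] by simp
  have "act s g \<cdot> (lact \<boxtimes> \<I> w) = lact \<cdot> ((\<I> A \<boxtimes> ins s g) \<cdot> (as A B w \<cdot>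
      (((mA \<boxtimes> \<I> B) \<boxtimes> \<I> w) \<cdot> (ai A A B \<boxtimes> \<I> w))))"
    by (simp add: act_def lact_def interch)
  also have "\<dots> = lact \<cdot> ((mA \<boxtimes> ins s g) \<cdot> (as (A \<otimes> A) B w \<cdot> (ai A A B \<boxtimes> \<I> w)))"
    by (simp add: natural) (simp add: interch)
  also have "\<dots> = lact \<cdot> ((mA \<boxtimes> \<I> X) \<cdot> (((\<I> A \<boxtimes> \<I> A) \<boxtimes> ins s g) \<cdot> (ai A A (B \<otimes> w) \<cdot>
      ((\<I> A \<boxtimes> as A B w) \<cdot> as A X w))))"
    by (subst pentagon_inv1) (simp_all add: interch)
  also have "\<dots> = lact \<cdot> ((mA \<boxtimes> \<I> X) \<cdot> (ai A A X \<cdot> ((\<I> A \<boxtimes> (\<I> A \<boxtimes> ins s g)) \<cdot>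
      ((\<I> A \<boxtimes> as A B w) \<cdot> as A X w))))"
    by (subst inv_assoc_nat') auto
  also have "\<dots> = lact \<cdot> ((\<I> A \<boxtimes> act s g) \<cdot> as A X w)"
    by (simp add: comp_reduce[OF lact_assoc] act_def interch)
  finally show ?thesis .
qed

text \<open>Compatibility of \<open>s\<close> with \<open>mB\<close> lets \<open>w\<close> cross the
  two factors \<open>B\<close> one after the other; \<open>ract_assoc\<close> then multiplies them
  in separately.\<close>

lemma ins_mult:
  assumes s: "entwines w s" and [simp]: "arr g" "src g = w" "trg g = X"
  shows "ins s g \<cdot> (mB \<boxtimes> \<I> w) =
    ract \<cdot> ((ins s g \<boxtimes> \<I> B) \<cdot> (ai B w B \<cdot> ((\<I> B \<boxtimes> s) \<cdot> as B B w)))"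
proof -
  note [simp] = entwinesD(1-4)[OF s]
  have "ins s g \<cdot> (mB \<boxtimes> \<I> w) = ract \<cdot> ((g \<boxtimes> \<I> B) \<cdot> ((\<I> w \<boxtimes> mB) \<cdot> (as w B B \<cdot>
      ((s \<boxtimes> \<I> B) \<cdot> (ai B w B \<cdot> ((\<I> B \<boxtimes> s) \<cdot> as B B w))))))"
    by (simp add: ins_def entwinesD(5)[OF s])
  also have "\<dots> = ract \<cdot> ((\<I> X \<boxtimes> mB) \<cdot> ((g \<boxtimes> (\<I> B \<boxtimes> \<I> B)) \<cdot> (as w B B \<cdot>
      ((s \<boxtimes> \<I> B) \<cdot> (ai B w B \<cdot> ((\<I> B \<boxtimes> s) \<cdot> as B B w))))))"
    by (simp add: interch)
  also have "\<dots> = ract \<cdot> ((\<I> X \<boxtimes> mB) \<cdot> (as X B B \<cdot> (((g \<boxtimes> \<I> B) \<boxtimes> \<I> B) \<cdot>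
      ((s \<boxtimes> \<I> B) \<cdot> (ai B w B \<cdot> ((\<I> B \<boxtimes> s) \<cdot> as B B w))))))"
    by (subst assoc_nat') auto
  also have "\<dots> = ract \<cdot> ((ract \<boxtimes> \<I> B) \<cdot> (((g \<boxtimes> \<I> B) \<boxtimes> \<I> B) \<cdot>
      ((s \<boxtimes> \<I> B) \<cdot> (ai B w B \<cdot> ((\<I> B \<boxtimes> s) \<cdot> as B B w)))))"
    by (simp add: comp_reduce[OF ract_assoc])
  also have "\<dots> = ract \<cdot> ((ins s g \<boxtimes> \<I> B) \<cdot> (ai B w B \<cdot> ((\<I> B \<boxtimes> s) \<cdot> as B B w)))"
    by (simp add: ins_def interch)
  finally show ?thesis .
qed

text \<open>The right-hand counterpart of \<open>act_lact\<close>, twisted by the crossing since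
  \<open>w\<close> must pass the additional \<open>B\<close> before it can act on \<open>X\<close>.
  \<open>ins_mult\<close> gives the statement on \<open>B\<close>, and \<open>ract_lact\<close>
  carries it over to \<open>X\<close>.\<close>

lemma act_ract:
  assumes s: "entwines w s" and [simp]: "arr g" "src g = w" "trg g = X"
  shows "act s g \<cdot> (ract \<boxtimes> \<I> w) =
    ract \<cdot> ((act s g \<boxtimes> \<I> B) \<cdot> (ai X w B \<cdot> ((\<I> X \<boxtimes> s) \<cdot> as X B w)))"
proof -
  note [simp] = entwinesD(1-4)[OF s]
  have "act s g \<cdot> (ract \<boxtimes> \<I> w) = lact \<cdot> ((\<I> A \<boxtimes> ins s g) \<cdot> (as A B w \<cdot>
      (((\<I> A \<boxtimes> mB) \<boxtimes> \<I> w) \<cdot> (as A B B \<boxtimes> \<I> w))))"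
    by (simp add: act_def ract_def interch)
  also have "\<dots> = lact \<cdot> ((\<I> A \<boxtimes> (ins s g \<cdot> (mB \<boxtimes> \<I> w))) \<cdot>
      (as A (B \<otimes> B) w \<cdot> (as A B B \<boxtimes> \<I> w)))"
    by (simp add: natural) (simp add: interch)
  also have "\<dots> = lact \<cdot> ((\<I> A \<boxtimes> (ract \<cdot> ((ins s g \<boxtimes> \<I> B) \<cdot> (ai B w B \<cdot> (\<I> B \<boxtimes> s))))) \<cdot>
      ((\<I> A \<boxtimes> as B B w) \<cdot> (as A (B \<otimes> B) w \<cdot> (as A B B \<boxtimes> \<I> w))))"
    by (simp add: ins_mult[OF s] interch)
  also have "\<dots> = lact \<cdot> ((\<I> A \<boxtimes> (ract \<cdot> ((ins s g \<boxtimes> \<I> B) \<cdot> (ai B w B \<cdot> (\<I> B \<boxtimes> s))))) \<cdot>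
      (as A B (B \<otimes> w) \<cdot> as X B w))"
    by (subst pentagon') auto
  also have "\<dots> = lact \<cdot> ((\<I> A \<boxtimes> ract) \<cdot> ((\<I> A \<boxtimes> (ins s g \<boxtimes> \<I> B)) \<cdot> ((\<I> A \<boxtimes> ai B w B) \<cdot>
      (as A B (w \<otimes> B) \<cdot> ((\<I> X \<boxtimes> s) \<cdot> as X B w)))))"
    by (simp add: natural interch)
  \<comment> \<open>Regrouped so that \<open>pentagon_inv2\<close>, read from right to left,
    matches.\<close>
  also have "\<dots> = lact \<cdot> ((\<I> A \<boxtimes> ract) \<cdot> ((\<I> A \<boxtimes> (ins s g \<boxtimes> \<I> B)) \<cdot> (((\<I> A \<boxtimes> ai B w B) \<cdot>
      as A B (w \<otimes> B)) \<cdot> ((\<I> X \<boxtimes> s) \<cdot> as X B w))))"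
    by simp
  also have "\<dots> = lact \<cdot> ((\<I> A \<boxtimes> ract) \<cdot> ((\<I> A \<boxtimes> (ins s g \<boxtimes> \<I> B)) \<cdot> (as A (B \<otimes> w) B \<cdot>
      ((as A B w \<boxtimes> \<I> B) \<cdot> (ai X w B \<cdot> ((\<I> X \<boxtimes> s) \<cdot> as X B w))))))"
    by (subst pentagon_inv2[symmetric]) simp_all
  also have "\<dots> = lact \<cdot> ((\<I> A \<boxtimes> ract) \<cdot> (as A X B \<cdot> (((\<I> A \<boxtimes> ins s g) \<boxtimes> \<I> B) \<cdot>
      ((as A B w \<boxtimes> \<I> B) \<cdot> (ai X w B \<cdot> ((\<I> X \<boxtimes> s) \<cdot> as X B w))))))"
    by (subst assoc_nat') auto
  also have "\<dots> = ract \<cdot> ((lact \<boxtimes> \<I> B) \<cdot> (((\<I> A \<boxtimes> ins s g) \<boxtimes> \<I> B) \<cdot>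
      ((as A B w \<boxtimes> \<I> B) \<cdot> (ai X w B \<cdot> ((\<I> X \<boxtimes> s) \<cdot> as X B w)))))"
    by (simp add: comp_reduce[OF ract_lact])
  also have "\<dots> = ract \<cdot> ((act s g \<boxtimes> \<I> B) \<cdot> (ai X w B \<cdot> ((\<I> X \<boxtimes> s) \<cdot> as X B w)))"
    by (simp add: act_def interch)
  finally show ?thesis .
qed

text \<open>The crossing for \<open>z \<otimes> w\<close>: \<open>B\<close> passes \<open>z\<close>
  by \<open>s\<close>, then \<open>w\<close> by \<open>t\<close>. For central objects it is the
  crossing of their tensor product, by \<open>cross_tensor\<close>.\<close>

definition entwine_tensor :: "'o \<Rightarrow> 'm \<Rightarrow> 'o \<Rightarrow> 'm \<Rightarrow> 'm" where
  "entwine_tensor z s w t =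
     ai z w B \<cdot> ((\<I> z \<boxtimes> t) \<cdot> (as z B w \<cdot> ((s \<boxtimes> \<I> w) \<cdot> ai B z w)))"

text \<open>Associativity of nesting. \<open>act t h\<close> moves inwards through
  \<open>lact\<close> by \<open>act_lact\<close> and through \<open>ract\<close> by
  \<open>act_ract\<close> until it meets \<open>g\<close>; what remains is the crossing of
  \<open>z \<otimes> w\<close> and the nested map
  \<open>act t h \<cdot> (g \<boxtimes> \<I> w)\<close>.\<close>

lemma act_act:
  assumes [simp]: "arr s" "src s = B \<otimes> z" "trg s = z \<otimes> B" "arr g" "src g = z" "trg g = X"
    and t: "entwines w t" and [simp]: "arr h" "src h = w" "trg h = X"
  shows "act t h \<cdot> (act s g \<boxtimes> \<I> w) =
    act (entwine_tensor z s w t) (act t h \<cdot> (g \<boxtimes> \<I> w)) \<cdot> as X z w"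
proof -
  have [simp]: "z \<in> Ob C"
    using arr_Ob(1)[of g] by simp
  note [simp] = entwinesD(1-4)[OF t]
  let ?gh = "act t h \<cdot> (g \<boxtimes> \<I> w)" and ?st = "entwine_tensor z s w t"
  have st: "?st \<cdot> as B z w = ai z w B \<cdot> ((\<I> z \<boxtimes> t) \<cdot> (as z B w \<cdot> (s \<boxtimes> \<I> w)))"
    by (simp add: entwine_tensor_def)
  have [simp]: "arr ?st" "src ?st = B \<otimes> (z \<otimes> w)" "trg ?st = (z \<otimes> w) \<otimes> B"
    by (simp_all add: entwine_tensor_def)
  \<comment> \<open>First the part on \<open>B \<otimes> z\<close>; the second calculation adds
    \<open>A\<close>.\<close>
  have "act t h \<cdot> (ins s g \<boxtimes> \<I> w) =
      act t h \<cdot> ((ract \<boxtimes> \<I> w) \<cdot> (((g \<boxtimes> \<I> B) \<boxtimes> \<I> w) \<cdot> (s \<boxtimes> \<I> w)))"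
    by (simp add: ins_def interch)
  also have "\<dots> = ract \<cdot> ((act t h \<boxtimes> \<I> B) \<cdot> (ai X w B \<cdot> ((\<I> X \<boxtimes> t) \<cdot> (as X B w \<cdot>
      (((g \<boxtimes> \<I> B) \<boxtimes> \<I> w) \<cdot> (s \<boxtimes> \<I> w))))))"
    by (simp add: comp_reduce[OF act_ract[OF t]])
  also have "\<dots> = ract \<cdot> ((act t h \<boxtimes> \<I> B) \<cdot> (ai X w B \<cdot> ((g \<boxtimes> (\<I> w \<boxtimes> \<I> B)) \<cdot> ((\<I> z \<boxtimes> t) \<cdot>
      (as z B w \<cdot> (s \<boxtimes> \<I> w))))))"
    by (simp add: natural) (simp add: interch)
  also have "\<dots> = ract \<cdot> ((act t h \<boxtimes> \<I> B) \<cdot> (((g \<boxtimes> \<I> w) \<boxtimes> \<I> B) \<cdot> (ai z w B \<cdot> ((\<I> z \<boxtimes> t) \<cdot>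
      (as z B w \<cdot> (s \<boxtimes> \<I> w))))))"
    by (subst inv_assoc_nat') simp_all
  also have "\<dots> = ins ?st ?gh \<cdot> as B z w"
    by (simp add: ins_def st interch)
  finally have ins: "act t h \<cdot> (ins s g \<boxtimes> \<I> w) = ins ?st ?gh \<cdot> as B z w" .
  have "act t h \<cdot> (act s g \<boxtimes> \<I> w) = act t h \<cdot> ((lact \<boxtimes> \<I> w) \<cdot>
      (((\<I> A \<boxtimes> ins s g) \<boxtimes> \<I> w) \<cdot> (as A B z \<boxtimes> \<I> w)))"
    by (simp add: act_def[of s] interch)
  also have "\<dots> = lact \<cdot> ((\<I> A \<boxtimes> act t h) \<cdot> (as A X w \<cdot>
      (((\<I> A \<boxtimes> ins s g) \<boxtimes> \<I> w) \<cdot> (as A B z \<boxtimes> \<I> w))))"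
    by (simp add: comp_reduce[OF act_lact])
  also have "\<dots> = lact \<cdot> ((\<I> A \<boxtimes> (act t h \<cdot> (ins s g \<boxtimes> \<I> w))) \<cdot>
      (as A (B \<otimes> z) w \<cdot> (as A B z \<boxtimes> \<I> w)))"
    by (simp add: natural) (simp add: interch)
  also have "\<dots> = lact \<cdot> ((\<I> A \<boxtimes> ins ?st ?gh) \<cdot> ((\<I> A \<boxtimes> as B z w) \<cdot>
      (as A (B \<otimes> z) w \<cdot> (as A B z \<boxtimes> \<I> w))))"
    by (simp add: ins interch)
  also have "\<dots> = lact \<cdot> ((\<I> A \<boxtimes> ins ?st ?gh) \<cdot> (as A B (z \<otimes> w) \<cdot> as X z w))"
    by (subst pentagon') auto
  also have "\<dots> = act ?st ?gh \<cdot> as X z w"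
    by (simp add: act_def[of ?st])
  finally show ?thesis .
qed

lemma act_nat:
  assumes [simp]: "arr s" "src s = B \<otimes> src u" "trg s = src u \<otimes> B"
    "arr t" "src t = B \<otimes> trg u" "trg t = trg u \<otimes> B"
    "arr g" "src g = trg u" "trg g = X" "arr u"
    and u: "t \<cdot> (\<I> B \<boxtimes> u) = (u \<boxtimes> \<I> B) \<cdot> s"
  shows "act t g \<cdot> (\<I> X \<boxtimes> u) = act s (g \<cdot> u)"
  by (simp add: act_def natural interch ins_def u)

section \<open>Units for the nesting action\<close>

definition unit_pair where "unit_pair = (iA \<boxtimes> iB) \<cdot> \<ll>\<^sup>- \<one>"

lemma unit_pair_simps [simp]: "arr unit_pair" "src unit_pair = \<one>" "trg unit_pair = X"
  by (auto simp: unit_pair_def)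

lemma ract_unit: "ract \<cdot> (\<I> X \<boxtimes> iB) = \<rr> X"
  by (simp add: ract_def natural interch alg_laws runit_tensor)

lemma lact_unit: "lact \<cdot> (iA \<boxtimes> \<I> X) = \<ll> X"
proof -
  have "lact \<cdot> (iA \<boxtimes> \<I> X) = (\<ll> A \<boxtimes> \<I> B) \<cdot> ai \<one> A B"
    by (simp add: lact_def natural interch alg_laws)
  also have "\<dots> = \<ll> X"
    by (simp flip: lunit_tensor)
  finally show ?thesis .
qed

text \<open>On \<open>iB\<close> the crossing is trivial by the last condition in
  \<open>entwines\<close>, so \<open>g\<close> reaches \<open>lact\<close> unchanged, and
  \<open>iA\<close> acts trivially on it.\<close>

lemma act_unit_left:
  assumes s: "entwines z s" and [simp]: "arr g" "src g = z" "trg g = X"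
  shows "act s g \<cdot> (unit_pair \<boxtimes> \<I> z) = g \<cdot> \<ll> z"
proof -
  note [simp] = entwinesD(1-4)[OF s]
  have ins: "ins s g \<cdot> (iB \<boxtimes> \<I> z) = g \<cdot> \<ll> z"
  proof -
    have "ins s g \<cdot> (iB \<boxtimes> \<I> z) = ract \<cdot> ((\<I> X \<boxtimes> iB) \<cdot> ((g \<boxtimes> \<I> \<one>) \<cdot> (\<rr>\<^sup>- z \<cdot> \<ll> z)))"
      by (simp add: ins_def entwinesD(6)[OF s] interch)
    also have "\<dots> = g \<cdot> \<ll> z"
      by (simp add: comp_reduce[OF ract_unit] comp_reduce[OF runit_nat])
    finally show ?thesis .
  qed
  have "act s g \<cdot> (unit_pair \<boxtimes> \<I> z) = lact \<cdot> ((\<I> A \<boxtimes> ins s g) \<cdot> (as A B z \<cdot>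
      (((iA \<boxtimes> iB) \<boxtimes> \<I> z) \<cdot> (\<ll>\<^sup>- \<one> \<boxtimes> \<I> z))))"
    by (simp add: act_def unit_pair_def interch)
  also have "\<dots> = lact \<cdot> ((iA \<boxtimes> \<I> X) \<cdot> ((\<I> \<one> \<boxtimes> (g \<cdot> \<ll> z)) \<cdot> (as \<one> \<one> z \<cdot> (\<ll>\<^sup>- \<one> \<boxtimes> \<I> z))))"
    by (simp add: natural) (simp add: interch ins)
  also have "\<dots> = g \<cdot> (\<ll> z \<cdot> ((\<ll> (\<one> \<otimes> z) \<cdot> as \<one> \<one> z) \<cdot> (\<ll>\<^sup>- \<one> \<boxtimes> \<I> z)))"
    by (simp add: comp_reduce[OF lact_unit] comp_reduce[OF lunit_nat])
  also have "\<dots> = g \<cdot> \<ll> z"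
    by (subst lunit_tensor) (simp_all add: interch)
  finally show ?thesis .
qed

text \<open>\<open>\<ll>\<^sup>- B \<cdot> \<rr> B\<close> is the crossing of the unit object, see
  \<open>cross_unit\<close>. Nesting the pair of units multiplies \<open>iA\<close> into
  \<open>A\<close> and \<open>iB\<close> into \<open>B\<close>.\<close>

lemma act_unit_right: "act (\<ll>\<^sup>- B \<cdot> \<rr> B) unit_pair = \<rr> X"
proof -
  have "ract \<cdot> (unit_pair \<boxtimes> \<I> B) =
      (\<I> A \<boxtimes> mB) \<cdot> (as A B B \<cdot> (((iA \<boxtimes> iB) \<boxtimes> \<I> B) \<cdot> (\<ll>\<^sup>- \<one> \<boxtimes> \<I> B)))"
    by (simp add: ract_def unit_pair_def interch)
  also have "\<dots> = (iA \<boxtimes> \<I> B) \<cdot> (((\<I> \<one> \<boxtimes> \<ll> B) \<cdot> as \<one> \<one> B) \<cdot> (\<ll>\<^sup>- \<one> \<boxtimes> \<I> B))"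
    by (simp add: natural) (simp add: interch alg_laws)
  also have "\<dots> = iA \<boxtimes> \<I> B"
    \<comment> \<open>The triangle produces \<open>\<rr> \<one>\<close>, while
      \<open>unit_pair\<close> contains the inverse of \<open>\<ll> \<one>\<close>;
      \<open>lunit_unit\<close> makes them cancel.\<close>
    by (simp add: triangle interch flip: lunit_unit)
  finally have r: "ract \<cdot> (unit_pair \<boxtimes> \<I> B) = iA \<boxtimes> \<I> B" .
  have "lact \<cdot> (\<I> A \<boxtimes> (iA \<boxtimes> \<I> B)) = (\<rr> A \<boxtimes> \<I> B) \<cdot> ai A \<one> B"
    by (simp add: lact_def natural interch alg_laws)
  also have "\<dots> = \<I> A \<boxtimes> \<ll> B"
    by (simp flip: triangle)
  finally have l: "lact \<cdot> (\<I> A \<boxtimes> (iA \<boxtimes> \<I> B)) = \<I> A \<boxtimes> \<ll> B" .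
  have "act (\<ll>\<^sup>- B \<cdot> \<rr> B) unit_pair =
      lact \<cdot> ((\<I> A \<boxtimes> (iA \<boxtimes> \<I> B)) \<cdot> ((\<I> A \<boxtimes> (\<ll>\<^sup>- B \<cdot> \<rr> B)) \<cdot> as A B \<one>))"
    by (simp add: act_def ins_def comp_reduce[OF r] interch)
  also have "\<dots> = \<rr> X"
    by (simp add: comp_reduce[OF l]) (simp add: comp_reduce[OF l] interch runit_tensor)
  finally show ?thesis .
qed

end

section \<open>Half-braidings\<close>

context tensor_category
begin

lemma half_braidingD:
  assumes "half_braiding C z e"
  shows "b \<in> Ob C \<Longrightarrow> is_iso C (z \<otimes> b) (b \<otimes> z) (e b)"
    "arr f \<Longrightarrow> src f = b \<Longrightarrow> trg f = c \<Longrightarrow> e c \<cdot> (\<I> z \<boxtimes> f) = (f \<boxtimes> \<I> z) \<cdot> e b"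
  using assms unfolding half_braiding_def by (auto simp: Hom_iff)

lemma half_braiding_simps:
  assumes "half_braiding C z e" "b \<in> Ob C"
  shows "arr (e b)" "src (e b) = z \<otimes> b" "trg (e b) = b \<otimes> z"
    "arr (inv_mor C (z \<otimes> b) (b \<otimes> z) (e b))"
    "src (inv_mor C (z \<otimes> b) (b \<otimes> z) (e b)) = b \<otimes> z"
    "trg (inv_mor C (z \<otimes> b) (b \<otimes> z) (e b)) = z \<otimes> b"
    "inv_mor C (z \<otimes> b) (b \<otimes> z) (e b) \<cdot> e b = \<I> (z \<otimes> b)"
    "e b \<cdot> inv_mor C (z \<otimes> b) (b \<otimes> z) (e b) = \<I> (b \<otimes> z)"
  using is_isoD[OF half_braidingD(1)[OF assms]] by auto

text \<open>The hexagon in the right-nested form that the simplifier works with.\<close>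

lemma half_braiding_tensor:
  assumes e: "half_braiding C z e" and [simp]: "z \<in> Ob C" "b \<in> Ob C" "c \<in> Ob C"
  shows "e (b \<otimes> c) = ai b c z \<cdot> ((\<I> b \<boxtimes> e c) \<cdot> (as b z c \<cdot> ((e b \<boxtimes> \<I> c) \<cdot> ai z b c)))"
proof -
  have "e (b \<otimes> c) = ai b c z \<cdot> (\<I> b \<boxtimes> e c) \<cdot> as b z c \<cdot> (e b \<boxtimes> \<I> c) \<cdot> ai z b c"
    using e by (simp add: half_braiding_def)
  then show ?thesis
    by (simp add: half_braiding_simps[OF e])
qed

text \<open>The unit condition is not part of a half-braiding; it follows by cancelling one of the two
  copies of \<open>e \<one>\<close> in the hexagon for \<open>\<one> \<otimes> \<one>\<close>.\<close>

lemma half_braiding_unit: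
  assumes e: "half_braiding C z e" and z [simp]: "z \<in> Ob C"
  shows "\<ll> z \<cdot> e \<one> = \<rr> z"
proof -
  note [simp] = half_braiding_simps[OF e]
  have "e \<one> \<cdot> (\<rr> z \<boxtimes> \<I> \<one>) = e \<one> \<cdot> ((\<I> z \<boxtimes> \<ll> \<one>) \<cdot> as z \<one> \<one>)"
    by (simp add: triangle)
  also have "\<dots> = (\<ll> \<one> \<boxtimes> \<I> z) \<cdot> (e (\<one> \<otimes> \<one>) \<cdot> as z \<one> \<one>)"
    by (simp add: comp_reduce[OF half_braidingD(2)[OF e]])
  also have "\<dots> = ((\<ll> \<one> \<boxtimes> \<I> z) \<cdot> ai \<one> \<one> z) \<cdot>
      ((\<I> \<one> \<boxtimes> e \<one>) \<cdot> (as \<one> z \<one> \<cdot> (e \<one> \<boxtimes> \<I> \<one>)))"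
    by (simp add: half_braiding_tensor[OF e])
  \<comment> \<open>With the unitor of a product in front, naturality of \<open>\<ll>\<close> pulls
    one copy of \<open>e \<one>\<close> to the outside, where it matches the left-hand side.\<close>
  also have "(\<ll> \<one> \<boxtimes> \<I> z) \<cdot> ai \<one> \<one> z = \<ll> (\<one> \<otimes> z)"
    by (simp flip: lunit_tensor)
  also have "\<ll> (\<one> \<otimes> z) \<cdot> ((\<I> \<one> \<boxtimes> e \<one>) \<cdot> (as \<one> z \<one> \<cdot> (e \<one> \<boxtimes> \<I> \<one>))) =
      e \<one> \<cdot> ((\<ll> (z \<otimes> \<one>) \<cdot> as \<one> z \<one>) \<cdot> (e \<one> \<boxtimes> \<I> \<one>))"
    by (simp add: comp_reduce[OF lunit_nat])
  also have "\<dots> = e \<one> \<cdot> ((\<ll> z \<cdot> e \<one>) \<boxtimes> \<I> \<one>)"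
    by (subst lunit_tensor) (simp_all add: interch)
  finally have "e \<one> \<cdot> (\<rr> z \<boxtimes> \<I> \<one>) = e \<one> \<cdot> ((\<ll> z \<cdot> e \<one>) \<boxtimes> \<I> \<one>)" .
  then have "\<rr> z \<boxtimes> \<I> \<one> = (\<ll> z \<cdot> e \<one>) \<boxtimes> \<I> \<one>"
    by (rule iso_cancel_left[OF half_braidingD(1)[OF e unit_Ob], rotated -1]) auto
  then have "\<rr> z = \<ll> z \<cdot> e \<one>"
    by (rule whisker_right_faithful[rotated -1]) auto
  then show ?thesis ..
qed

lemma half_braiding_unit_inv:
  assumes e: "half_braiding C z e" and z [simp]: "z \<in> Ob C"
  shows "inv_mor C (z \<otimes> \<one>) (\<one> \<otimes> z) (e \<one>) = \<rr>\<^sup>- z \<cdot> \<ll> z"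
proof -
  note [simp] = half_braiding_simps[OF e]
  have "e \<one> = \<ll>\<^sup>- z \<cdot> (\<ll> z \<cdot> e \<one>)"
    by simp
  then have "e \<one> = \<ll>\<^sup>- z \<cdot> \<rr> z"
    by (simp only: half_braiding_unit[OF e z])
  then show ?thesis
    by (intro inv_mor_eqI) (auto simp: Hom_iff)
qed

end

section \<open>Crossings of \<open>B\<close> with central objects\<close>

context algebra_pair
begin

text \<open>The action uses a half-braiding only at \<open>B\<close>, and inverted, because the
  central object stands to the right of \<open>B\<close> and has to move left.\<close>

definition cross :: "'o \<times> ('o \<Rightarrow> 'm) \<Rightarrow> 'm" where
  "cross Z = inv_mor C (fst Z \<otimes> B) (B \<otimes> fst Z) (snd Z B)"

text \<open>Naturality of the half-braiding at \<open>mB\<close> and \<open>iB\<close>, conjugated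
  by inverses. The hexagon supplies the inverse at \<open>B \<otimes> B\<close>, and
  \<open>half_braiding_unit_inv\<close> the one at \<open>\<one>\<close>.\<close>

lemma entwines_cross:
  assumes "Z \<in> center_Ob C"
  shows "entwines (fst Z) (cross Z)"
proof -
  obtain z e where Z: "Z = (z, e)" and z [simp]: "z \<in> Ob C" and e: "half_braiding C z e"
    using assms by (auto simp: center_Ob_def)
  note [simp] = half_braiding_simps[OF e]
  let ?s = "inv_mor C (z \<otimes> B) (B \<otimes> z) (e B)"
  \<comment> \<open>The inverse of \<open>e (B \<otimes> B)\<close>: the factors of the hexagon,
    inverted and in reverse order.\<close>
  let ?k = "as z B B \<cdot> ((?s \<boxtimes> \<I> B) \<cdot> (ai B z B \<cdot> ((\<I> B \<boxtimes> ?s) \<cdot> as B B z)))"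
  have k: "e (B \<otimes> B) \<cdot> ?k = \<I> ((B \<otimes> B) \<otimes> z)"
    by (simp add: half_braiding_tensor[OF e] interch)
  have "?s \<cdot> (mB \<boxtimes> \<I> z) = ?s \<cdot> ((mB \<boxtimes> \<I> z) \<cdot> (e (B \<otimes> B) \<cdot> ?k))"
    unfolding k by simp
  also have "\<dots> = ?s \<cdot> (((mB \<boxtimes> \<I> z) \<cdot> e (B \<otimes> B)) \<cdot> ?k)"
    by simp
  also have "\<dots> = (?s \<cdot> e B) \<cdot> ((\<I> z \<boxtimes> mB) \<cdot> ?k)"
    by (subst half_braidingD(2)[OF e, where c = B, symmetric])
      (simp_all add: comp_reduce[OF half_braiding_simps(7)[OF e]])
  also have "\<dots> = (\<I> z \<boxtimes> mB) \<cdot> ?k"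
    by simp
  finally have mult: "?s \<cdot> (mB \<boxtimes> \<I> z) = (\<I> z \<boxtimes> mB) \<cdot> ?k" .
  let ?t = "inv_mor C (z \<otimes> \<one>) (\<one> \<otimes> z) (e \<one>)"
  have "?s \<cdot> (iB \<boxtimes> \<I> z) = ?s \<cdot> (((iB \<boxtimes> \<I> z) \<cdot> e \<one>) \<cdot> ?t)"
    by simp
  also have "\<dots> = (?s \<cdot> e B) \<cdot> ((\<I> z \<boxtimes> iB) \<cdot> ?t)"
    by (subst half_braidingD(2)[OF e, where c = B, symmetric])
      (simp_all add: comp_reduce[OF half_braiding_simps(7)[OF e]])
  also have "\<dots> = (\<I> z \<boxtimes> iB) \<cdot> (\<rr>\<^sup>- z \<cdot> \<ll> z)"
    by (simp add: half_braiding_unit_inv[OF e])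
  finally show ?thesis
    using mult by (simp add: entwines_def cross_def Z Hom_iff)
qed

lemma cross_simps:
  assumes "Z \<in> center_Ob C"
  shows "fst Z \<in> Ob C" "arr (cross Z)" "src (cross Z) = B \<otimes> fst Z" "trg (cross Z) = fst Z \<otimes> B"
  by (rule entwinesD(1-4)[OF entwines_cross[OF assms]])+

text \<open>Inverting the five factors of the half-braiding of a tensor product and reversing their
  order yields \<open>entwine_tensor\<close>.\<close>

lemma cross_tensor:
  assumes "Z \<in> center_Ob C" "W \<in> center_Ob C"
  shows "cross (center_tensor C Z W) = entwine_tensor (fst Z) (cross Z) (fst W) (cross W)"
proof -
  obtain z e where Z: "Z = (z, e)" and z [simp]: "z \<in> Ob C" and e: "half_braiding C z e"
    using assms by (auto simp: center_Ob_def)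
  obtain w d where W: "W = (w, d)" and w [simp]: "w \<in> Ob C" and d: "half_braiding C w d"
    using assms by (auto simp: center_Ob_def)
  note eB = half_braidingD(1)[OF e alg_simps(8)] and dB = half_braidingD(1)[OF d alg_simps(8)]
  \<comment> \<open>\<open>f1\<close> to \<open>f5\<close> are the factors in order of application;
    \<open>g4\<close>, \<open>g3\<close>, \<open>g2\<close> collect composites following the
    left-nested bracketing in \<open>center_tensor\<close>.\<close>
  note f1 = assoc_iso[OF z w alg_simps(8)]
    and f2 = is_iso_tensor[OF is_iso_ident[OF z] dB]
    and f3 = inv_assoc_iso[OF z alg_simps(8) w]
    and f4 = is_iso_tensor[OF eB is_iso_ident[OF w]]
    and f5 = assoc_iso[OF alg_simps(8) z w]
  note g4 = is_iso_comp[OF f4 f5]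
  note g3 = is_iso_comp[OF f3 g4]
  note g2 = is_iso_comp[OF f2 g3]
  have inv: "inv_mor C ((z \<otimes> w) \<otimes> B) (B \<otimes> (z \<otimes> w))
      (as B z w \<cdot> (e B \<boxtimes> \<I> w) \<cdot> ai z B w \<cdot> (\<I> z \<boxtimes> d B) \<cdot> as z w B) =
      ai z w B \<cdot> ((\<I> z \<boxtimes> inv_mor C (w \<otimes> B) (B \<otimes> w) (d B)) \<cdot>
        (as z B w \<cdot> ((inv_mor C (z \<otimes> B) (B \<otimes> z) (e B) \<boxtimes> \<I> w) \<cdot> ai B z w)))"
    unfolding inv_mor_comp[OF f1 g2] inv_mor_comp[OF f2 g3] inv_mor_comp[OF f3 g4]
      inv_mor_comp[OF f4 f5] inv_mor_tensor[OF is_iso_ident[OF z] dB]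
      inv_mor_tensor[OF eB is_iso_ident[OF w]]
    by (simp only: inv_mor_ident inv_mor_inv_assoc alg_simps(8) z w flip: inv_assoc_def)
  show ?thesis
    unfolding cross_def entwine_tensor_def center_tensor_def Z W fst_conv snd_conv
      restrict_apply'[OF alg_simps(8)] by (rule inv)
qed

lemma cross_unit: "cross (center_unit C) = \<ll>\<^sup>- B \<cdot> \<rr> B"
  by (subst cross_def, intro inv_mor_eqI) (simp_all add: Hom_iff center_unit_def)

text \<open>The defining condition of a morphism of the center at \<open>B\<close>, conjugated by
  the two inverse half-braidings.\<close>

lemma cross_nat:
  assumes "(Z, u, W) \<in> center_Hom C Z W"
  shows "cross W \<cdot> (\<I> B \<boxtimes> u) = (u \<boxtimes> \<I> B) \<cdot> cross Z"
proof -
  have Z: "Z \<in> center_Ob C" and W: "W \<in> center_Ob C"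
    and [simp]: "arr u" "src u = fst Z" "trg u = fst W"
    and u: "snd W B \<cdot> (u \<boxtimes> \<I> B) = (\<I> B \<boxtimes> u) \<cdot> snd Z B"
    using assms by (auto simp: center_Hom_def Hom_iff)
  have e: "half_braiding C (fst Z) (snd Z)" "half_braiding C (fst W) (snd W)"
    using Z W by (auto simp: center_Ob_def)
  note [simp] = cross_simps[OF Z] cross_simps[OF W]
    half_braiding_simps[OF e(1)] half_braiding_simps[OF e(2)]
  have inv: "snd Z B \<cdot> cross Z = \<I> (B \<otimes> fst Z)" "cross W \<cdot> snd W B = \<I> (fst W \<otimes> B)"
    by (simp_all add: cross_def)
  have "cross W \<cdot> (\<I> B \<boxtimes> u) = cross W \<cdot> (((\<I> B \<boxtimes> u) \<cdot> snd Z B) \<cdot> cross Z)"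
    by (simp add: inv)
  also have "\<dots> = (u \<boxtimes> \<I> B) \<cdot> cross Z"
    unfolding u[symmetric] by (simp add: comp_reduce[OF inv(2)])
  finally show ?thesis .
qed

end

section \<open>Transport along the adjunction\<close>

text \<open>The component of the counit at \<open>x\<close> is a universal arrow from
  \<open>L\<close> to \<open>x\<close>; the algebra structure is transported through this unique
  factorization.\<close>

lemma right_adjoint_universal:
  fixes C :: "('o, 'm, 'x) category_scheme" and D :: "('p, 'n, 'y) category_scheme"
  assumes "category C" "category D" "right_adjoint C D L R" and x: "x \<in> Ob D"
  shows "fun_ob R x \<in> Ob C"
    and "\<exists>eps. eps \<in> Hom D (fun_ob L (fun_ob R x)) x \<and>
      (\<forall>a\<in>Ob C. \<forall>f\<in>Hom D (fun_ob L a) x.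
        \<exists>!p. p \<in> Hom C a (fun_ob R x) \<and> eps \<cdot>\<^bsub>D\<^esub> fun_mor L p = f)"
proof -
  interpret C: category C by fact
  interpret D: category D by fact
  obtain \<eta> \<epsilon> where LR: "is_functor C D L" "is_functor D C R"
    and eta: "nat_trans C C ident_functor (comp_functor R L) \<eta>"
    and eps: "nat_trans D D (comp_functor L R) ident_functor \<epsilon>"
    and zig: "\<And>a. a \<in> Ob C \<Longrightarrow> \<epsilon> (fun_ob L a) \<cdot>\<^bsub>D\<^esub> fun_mor L (\<eta> a) = \<I>\<^bsub>D\<^esub> (fun_ob L a)"
    and zag: "\<And>x. x \<in> Ob D \<Longrightarrow> fun_mor R (\<epsilon> x) \<cdot>\<^bsub>C\<^esub> \<eta> (fun_ob R x) = \<I>\<^bsub>C\<^esub> (fun_ob R x)"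
    using assms(3) unfolding right_adjoint_def by blast
  have LH: "fun_mor L f \<in> Hom D (fun_ob L a) (fun_ob L b)" if "f \<in> Hom C a b" for f a b
    using LR(1) that by (auto simp: is_functor_def)
  have RH: "fun_mor R f \<in> Hom C (fun_ob R a) (fun_ob R b)" if "f \<in> Hom D a b" for f a b
    using LR(2) that by (auto simp: is_functor_def)
  have LC: "fun_mor L (g \<cdot>\<^bsub>C\<^esub> f) = fun_mor L g \<cdot>\<^bsub>D\<^esub> fun_mor L f"
    if "f \<in> Hom C a b" "g \<in> Hom C b c" for f g a b c
    using LR(1) that by (auto simp: is_functor_def)
  have RC: "fun_mor R (g \<cdot>\<^bsub>D\<^esub> f) = fun_mor R g \<cdot>\<^bsub>C\<^esub> fun_mor R f"
    if "f \<in> Hom D a b" "g \<in> Hom D b c" for f g a b c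
    using LR(2) that by (auto simp: is_functor_def)
  have LO: "fun_ob L a \<in> Ob D" if "a \<in> Ob C" for a
    using LR(1) that by (auto simp: is_functor_def)
  show Rx: "fun_ob R x \<in> Ob C"
    using LR(2) x by (auto simp: is_functor_def)
  have etaH: "\<eta> a \<in> Hom C a (fun_ob R (fun_ob L a))" if "a \<in> Ob C" for a
    using eta that by (auto simp: nat_trans_def ident_functor_def comp_functor_def)
  have epsH: "\<epsilon> x \<in> Hom D (fun_ob L (fun_ob R x)) x" if "x \<in> Ob D" for x
    using eps that by (auto simp: nat_trans_def ident_functor_def comp_functor_def)
  have etaN: "\<eta> b \<cdot>\<^bsub>C\<^esub> f = fun_mor R (fun_mor L f) \<cdot>\<^bsub>C\<^esub> \<eta> a" if "f \<in> Hom C a b" for f a b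
    using eta that by (auto simp: nat_trans_def ident_functor_def comp_functor_def)
  have epsN: "\<epsilon> b \<cdot>\<^bsub>D\<^esub> fun_mor L (fun_mor R f) = f \<cdot>\<^bsub>D\<^esub> \<epsilon> a" if "f \<in> Hom D a b" for f a b
    using eps that by (auto simp: nat_trans_def ident_functor_def comp_functor_def)
  have "\<exists>!p. p \<in> Hom C a (fun_ob R x) \<and> \<epsilon> x \<cdot>\<^bsub>D\<^esub> fun_mor L p = f"
    if a: "a \<in> Ob C" and f: "f \<in> Hom D (fun_ob L a) x" for a f
  \<comment> \<open>The witness is the adjoint transpose of \<open>f\<close>. One triangle identity,
    at \<open>fun_ob L a\<close>, shows that it factors \<open>f\<close>; the other, at
    \<open>fun_ob R x\<close>, that every factorization equals it.\<close>
  proof (rule ex1I[where a = "fun_mor R f \<cdot>\<^bsub>C\<^esub> \<eta> a"])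
    have "\<epsilon> x \<cdot>\<^bsub>D\<^esub> fun_mor L (fun_mor R f \<cdot>\<^bsub>C\<^esub> \<eta> a) =
        \<epsilon> x \<cdot>\<^bsub>D\<^esub> (fun_mor L (fun_mor R f) \<cdot>\<^bsub>D\<^esub> fun_mor L (\<eta> a))"
      by (simp add: LC[OF etaH[OF a] RH[OF f]])
    also have "\<dots> = (\<epsilon> x \<cdot>\<^bsub>D\<^esub> fun_mor L (fun_mor R f)) \<cdot>\<^bsub>D\<^esub> fun_mor L (\<eta> a)"
      using D.Comp_assoc[OF LH[OF etaH[OF a]] LH[OF RH[OF f]] epsH[OF x]] by simp
    also have "\<dots> = f \<cdot>\<^bsub>D\<^esub> (\<epsilon> (fun_ob L a) \<cdot>\<^bsub>D\<^esub> fun_mor L (\<eta> a))"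
      unfolding epsN[OF f] using D.Comp_assoc[OF LH[OF etaH[OF a]] epsH[OF LO[OF a]] f] .
    also have "\<dots> = f"
      unfolding zig[OF a] by (rule D.Comp_ident_right[OF f])
    finally show "fun_mor R f \<cdot>\<^bsub>C\<^esub> \<eta> a \<in> Hom C a (fun_ob R x) \<and>
        \<epsilon> x \<cdot>\<^bsub>D\<^esub> fun_mor L (fun_mor R f \<cdot>\<^bsub>C\<^esub> \<eta> a) = f"
      using C.Comp_Hom[OF etaH[OF a] RH[OF f]] by blast
  next
    fix p assume "p \<in> Hom C a (fun_ob R x) \<and> \<epsilon> x \<cdot>\<^bsub>D\<^esub> fun_mor L p = f"
    then have p: "p \<in> Hom C a (fun_ob R x)" and f': "f = \<epsilon> x \<cdot>\<^bsub>D\<^esub> fun_mor L p"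
      by auto
    have "fun_mor R f \<cdot>\<^bsub>C\<^esub> \<eta> a = fun_mor R (\<epsilon> x) \<cdot>\<^bsub>C\<^esub> (fun_mor R (fun_mor L p) \<cdot>\<^bsub>C\<^esub> \<eta> a)"
      unfolding f' RC[OF LH[OF p] epsH[OF x]]
      by (rule C.Comp_assoc[OF etaH[OF a] RH[OF LH[OF p]] RH[OF epsH[OF x]]])
    also have "\<dots> = (fun_mor R (\<epsilon> x) \<cdot>\<^bsub>C\<^esub> \<eta> (fun_ob R x)) \<cdot>\<^bsub>C\<^esub> p"
      unfolding etaN[OF p, symmetric]
      by (rule C.Comp_assoc[OF p etaH[OF Rx] RH[OF epsH[OF x]], symmetric])
    also have "\<dots> = p"
      unfolding zag[OF x] by (rule C.Comp_ident_left[OF p])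
    finally show "p = fun_mor R f \<cdot>\<^bsub>C\<^esub> \<eta> a" ..
  qed
  then show "\<exists>eps. eps \<in> Hom D (fun_ob L (fun_ob R x)) x \<and>
      (\<forall>a\<in>Ob C. \<forall>f\<in>Hom D (fun_ob L a) x.
        \<exists>!p. p \<in> Hom C a (fun_ob R x) \<and> eps \<cdot>\<^bsub>D\<^esub> fun_mor L p = f)"
    using epsH[OF x] by blast
qed

section \<open>Tensor functors into the center, read in \<open>M\<close>\<close>

locale central_functor = C: tensor_category C + algebra_pair M A B mA iA mB iB
  for C :: "('c, 'k, 'y) tensor_category_scheme"
    and M :: "('o, 'm, 'x) pivotal_category_scheme" (structure)
    and A B :: 'o and mA iA mB iB :: 'm +
  fixes G :: "('c, 'k, 'o \<times> ('o \<Rightarrow> 'm),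
               ('o \<times> ('o \<Rightarrow> 'm)) \<times> 'm \<times> ('o \<times> ('o \<Rightarrow> 'm))) tensor_functor"
  assumes G: "is_tensor_functor C (center M) G"
begin

text \<open>Morphisms of the center are triples, and \<open>mid\<close> is the underlying morphism.
  So \<open>F\<close>, \<open>Fm\<close>, \<open>MU\<close> and \<open>IO\<close> are the data of
  the composite tensor functor from \<open>C\<close> to \<open>M\<close>.\<close>

abbreviation mid :: "'p \<times> 'm \<times> 'p \<Rightarrow> 'm" where "mid t \<equiv> fst (snd t)"
abbreviation F where "F c \<equiv> fst (fun_ob G c)"
abbreviation Fm where "Fm f \<equiv> mid (fun_mor G f)"
abbreviation MU where "MU a b \<equiv> mid (mu G a b)"
abbreviation IO where "IO \<equiv> mid (iota G)"

text \<open>\<open>mid\<close> respects the operations of the center, so an equation there becomes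
  one in \<open>M\<close> by applying \<open>mid\<close> to both sides.\<close>

lemma center_sel:
  "Ob (center M) = center_Ob M" "Hom (center M) = center_Hom M"
  "mid (t \<cdot>\<^bsub>center M\<^esub> t') = mid t \<cdot> mid t'"
  "mid (t \<boxtimes>\<^bsub>center M\<^esub> t') = mid t \<boxtimes> mid t'"
  "mid (\<I>\<^bsub>center M\<^esub> W) = \<I> (fst W)"
  "W \<otimes>\<^bsub>center M\<^esub> W' = center_tensor M W W'" "\<one>\<^bsub>center M\<^esub> = center_unit M"
  "mid (assoc (center M) W W' W'') = as (fst W) (fst W') (fst W'')"
  "mid (\<ll>\<^bsub>center M\<^esub> W) = \<ll> (fst W)" "mid (\<rr>\<^bsub>center M\<^esub> W) = \<rr> (fst W)"
  "fst (center_tensor M W W') = fst W \<otimes> fst W'" "fst (center_unit M) = \<one>"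
  by (auto simp: center_def center_tensor_def center_unit_def split: prod.split)

lemma center_Hom_mid:
  assumes "t \<in> center_Hom M V W"
  shows "(V, mid t, W) \<in> center_Hom M V W" "mid t \<in> Hom M (fst V) (fst W)"
  using assms by (auto simp: center_Hom_def)

text \<open>Invertibility is needed to cancel \<open>MU\<close> and \<open>IO\<close>, centrality to
  slide them through crossings.\<close>

lemma center_iso_mid:
  assumes "is_iso (center M) V W t"
  shows "is_iso M (fst V) (fst W) (mid t)" "(V, mid t, W) \<in> center_Hom M V W"
proof -
  obtain t' where t: "t \<in> center_Hom M V W" "t' \<in> center_Hom M W V"
    and eq: "t' \<cdot>\<^bsub>center M\<^esub> t = \<I>\<^bsub>center M\<^esub> V" "t \<cdot>\<^bsub>center M\<^esub> t' = \<I>\<^bsub>center M\<^esub> W"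
    using assms by (auto simp: is_iso_def center_sel)
  show "is_iso M (fst V) (fst W) (mid t)"
    using center_Hom_mid(2)[OF t(1)] center_Hom_mid(2)[OF t(2)]
      arg_cong[OF eq(1), of mid] arg_cong[OF eq(2), of mid]
    by (auto simp: is_iso_def center_sel)
  show "(V, mid t, W) \<in> center_Hom M V W"
    by (rule center_Hom_mid[OF t(1)])
qed

lemma G_functor: "is_functor C (center M) G"
  using G by (simp add: is_tensor_functor_def)

lemma G_Ob: "c \<in> Ob C \<Longrightarrow> fun_ob G c \<in> center_Ob M"
  using G_functor by (auto simp: is_functor_def center_sel)

lemma F_Ob [simp]: "c \<in> Ob C \<Longrightarrow> F c \<in> Ob M"
  using cross_simps(1)[OF G_Ob] by blast

lemma Fm_central:
  assumes "C.arr f"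
  shows "(fun_ob G (C.src f), Fm f, fun_ob G (C.trg f)) \<in>
    center_Hom M (fun_ob G (C.src f)) (fun_ob G (C.trg f))"
proof (rule center_Hom_mid)
  show "fun_mor G f \<in> center_Hom M (fun_ob G (C.src f)) (fun_ob G (C.trg f))"
    using G_functor assms by (auto simp: is_functor_def center_sel C.Hom_iff)
qed

lemma Fm_simps [simp]:
  assumes "C.arr f"
  shows "arr (Fm f)" "src (Fm f) = F (C.src f)" "trg (Fm f) = F (C.trg f)"
  using center_Hom_mid(2)[OF Fm_central[OF assms]] by (auto simp: Hom_iff)

lemma Fm_comp:
  assumes "C.arr f" "C.arr g" "C.src g = C.trg f"
  shows "Fm (g \<cdot>\<^bsub>C\<^esub> f) = Fm g \<cdot> Fm f"
proof -
  have "fun_mor G (g \<cdot>\<^bsub>C\<^esub> f) = fun_mor G g \<cdot>\<^bsub>center M\<^esub> fun_mor G f"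
    using G_functor assms by (auto simp: is_functor_def C.Hom_iff)
  then show ?thesis
    by (simp add: center_sel)
qed

lemma Fm_ident: "c \<in> Ob C \<Longrightarrow> Fm (\<I>\<^bsub>C\<^esub> c) = \<I> (F c)"
  using G_functor by (simp add: is_functor_def center_sel)

lemma MU_iso:
  assumes "a \<in> Ob C" "b \<in> Ob C"
  shows "is_iso M (F a \<otimes> F b) (F (a \<otimes>\<^bsub>C\<^esub> b)) (MU a b)"
    "(center_tensor M (fun_ob G a) (fun_ob G b), MU a b, fun_ob G (a \<otimes>\<^bsub>C\<^esub> b)) \<in>
      center_Hom M (center_tensor M (fun_ob G a) (fun_ob G b)) (fun_ob G (a \<otimes>\<^bsub>C\<^esub> b))"
proof -
  have "is_iso (center M) (center_tensor M (fun_ob G a) (fun_ob G b)) (fun_ob G (a \<otimes>\<^bsub>C\<^esub> b)) (mu G a b)"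
    using G assms by (simp add: is_tensor_functor_def center_sel)
  from center_iso_mid[OF this]
  show "is_iso M (F a \<otimes> F b) (F (a \<otimes>\<^bsub>C\<^esub> b)) (MU a b)"
    "(center_tensor M (fun_ob G a) (fun_ob G b), MU a b, fun_ob G (a \<otimes>\<^bsub>C\<^esub> b)) \<in>
      center_Hom M (center_tensor M (fun_ob G a) (fun_ob G b)) (fun_ob G (a \<otimes>\<^bsub>C\<^esub> b))"
    by (simp_all add: center_sel)
qed

lemma IO_iso:
  "is_iso M \<one> (F \<one>\<^bsub>C\<^esub>) IO"
  "(center_unit M, IO, fun_ob G \<one>\<^bsub>C\<^esub>) \<in> center_Hom M (center_unit M) (fun_ob G \<one>\<^bsub>C\<^esub>)"
proof -
  have "is_iso (center M) (center_unit M) (fun_ob G \<one>\<^bsub>C\<^esub>) (iota G)"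
    using G by (simp add: is_tensor_functor_def center_sel)
  from center_iso_mid[OF this]
  show "is_iso M \<one> (F \<one>\<^bsub>C\<^esub>) IO"
    "(center_unit M, IO, fun_ob G \<one>\<^bsub>C\<^esub>) \<in> center_Hom M (center_unit M) (fun_ob G \<one>\<^bsub>C\<^esub>)"
    by (simp_all add: center_sel)
qed

lemmas MU_simps [simp] = is_isoD[OF MU_iso(1)]
lemmas IO_simps [simp] = is_isoD[OF IO_iso(1)]

lemma MU_nat:
  assumes "C.arr f" "C.arr g"
  shows "Fm (f \<boxtimes>\<^bsub>C\<^esub> g) \<cdot> MU (C.src f) (C.src g) = MU (C.trg f) (C.trg g) \<cdot> (Fm f \<boxtimes> Fm g)"
proof -
  have "mu G (C.trg f) (C.trg g) \<cdot>\<^bsub>center M\<^esub> (fun_mor G f \<boxtimes>\<^bsub>center M\<^esub> fun_mor G g) =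
      fun_mor G (f \<boxtimes>\<^bsub>C\<^esub> g) \<cdot>\<^bsub>center M\<^esub> mu G (C.src f) (C.src g)"
    using G assms by (auto simp: is_tensor_functor_def C.Hom_iff)
  from arg_cong[OF this, of mid] show ?thesis
    by (simp add: center_sel)
qed

lemma MU_assoc:
  assumes [simp]: "a \<in> Ob C" "b \<in> Ob C" "c \<in> Ob C"
  shows "Fm (assoc C a b c) \<cdot> (MU (a \<otimes>\<^bsub>C\<^esub> b) c \<cdot> (MU a b \<boxtimes> \<I> (F c))) =
    MU a (b \<otimes>\<^bsub>C\<^esub> c) \<cdot> ((\<I> (F a) \<boxtimes> MU b c) \<cdot> as (F a) (F b) (F c))"
proof -
  have "fun_mor G (assoc C a b c) \<cdot>\<^bsub>center M\<^esub> mu G (a \<otimes>\<^bsub>C\<^esub> b) c \<cdot>\<^bsub>center M\<^esub>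
        (mu G a b \<boxtimes>\<^bsub>center M\<^esub> \<I>\<^bsub>center M\<^esub> (fun_ob G c)) =
      mu G a (b \<otimes>\<^bsub>C\<^esub> c) \<cdot>\<^bsub>center M\<^esub> (\<I>\<^bsub>center M\<^esub> (fun_ob G a) \<boxtimes>\<^bsub>center M\<^esub> mu G b c) \<cdot>\<^bsub>center M\<^esub>
        assoc (center M) (fun_ob G a) (fun_ob G b) (fun_ob G c)"
    using G by (simp add: is_tensor_functor_def)
  from arg_cong[OF this, of mid] show ?thesis
    by (simp add: center_sel)
qed

lemma MU_unit:
  assumes [simp]: "a \<in> Ob C"
  shows "Fm (\<ll>\<^bsub>C\<^esub> a) \<cdot> (MU \<one>\<^bsub>C\<^esub> a \<cdot> (IO \<boxtimes> \<I> (F a))) = \<ll> (F a)"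
    "Fm (\<rr>\<^bsub>C\<^esub> a) \<cdot> (MU a \<one>\<^bsub>C\<^esub> \<cdot> (\<I> (F a) \<boxtimes> IO)) = \<rr> (F a)"
proof -
  have "fun_mor G (\<ll>\<^bsub>C\<^esub> a) \<cdot>\<^bsub>center M\<^esub> mu G \<one>\<^bsub>C\<^esub> a \<cdot>\<^bsub>center M\<^esub>
        (iota G \<boxtimes>\<^bsub>center M\<^esub> \<I>\<^bsub>center M\<^esub> (fun_ob G a)) = \<ll>\<^bsub>center M\<^esub> (fun_ob G a)"
    and "fun_mor G (\<rr>\<^bsub>C\<^esub> a) \<cdot>\<^bsub>center M\<^esub> mu G a \<one>\<^bsub>C\<^esub> \<cdot>\<^bsub>center M\<^esub>
        (\<I>\<^bsub>center M\<^esub> (fun_ob G a) \<boxtimes>\<^bsub>center M\<^esub> iota G) = \<rr>\<^bsub>center M\<^esub> (fun_ob G a)"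
    using G by (simp_all add: is_tensor_functor_def)
  from this[THEN arg_cong, of mid]
  show "Fm (\<ll>\<^bsub>C\<^esub> a) \<cdot> (MU \<one>\<^bsub>C\<^esub> a \<cdot> (IO \<boxtimes> \<I> (F a))) = \<ll> (F a)"
    "Fm (\<rr>\<^bsub>C\<^esub> a) \<cdot> (MU a \<one>\<^bsub>C\<^esub> \<cdot> (\<I> (F a) \<boxtimes> IO)) = \<rr> (F a)"
    by (simp_all add: center_sel)
qed

text \<open>\<open>act_nat\<close> with \<open>cross_nat\<close> as its sliding condition. It is
  applied below to images under \<open>Fm\<close>, to \<open>MU\<close> and to
  \<open>IO\<close>.\<close>

lemma act_central:
  assumes u: "(V, u, W) \<in> center_Hom M V W" and [simp]: "arr g" "src g = fst W" "trg g = X"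
  shows "act (cross W) g \<cdot> (\<I> X \<boxtimes> u) = act (cross V) (g \<cdot> u)"
proof -
  have V: "V \<in> center_Ob M" and W: "W \<in> center_Ob M"
    and [simp]: "arr u" "src u = fst V" "trg u = fst W"
    using u by (auto simp: center_Hom_def Hom_iff)
  show ?thesis
    by (rule act_nat) (simp_all add: cross_simps[OF V] cross_simps[OF W] cross_nat[OF u])
qed

text \<open>Existence in \<open>univ\<close> defines \<open>m\<close> and \<open>i\<close>. Each
  algebra law equates morphisms into \<open>T\<close>, so uniqueness reduces it to an equation in
  \<open>M\<close> after \<open>eps\<close>, where it becomes a property of
  \<open>act\<close>.\<close>

lemma algebra_of_universal:
  assumes T [simp]: "T \<in> Ob C" and eps: "eps \<in> Hom M (F T) X"
    and univ: "\<And>a f. a \<in> Ob C \<Longrightarrow> f \<in> Hom M (F a) X \<Longrightarrow> \<exists>!p. p \<in> Hom C a T \<and> eps \<cdot> Fm p = f"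
  shows "\<exists>m i. algebra_object C T m i"
proof -
  have [simp]: "arr eps" "src eps = F T" "trg eps = X"
    using eps by (auto simp: Hom_iff)
  \<comment> \<open>Nesting by the counit: \<open>eps\<close> turns \<open>F T\<close> into a copy
    of \<open>X\<close> placed inside the given one.\<close>
  define R where "R = act (cross (fun_ob G T)) eps"
  note cT [simp] = cross_simps[OF G_Ob[OF T]]
  have [simp]: "arr R" "src R = X \<otimes> F T" "trg R = X"
    by (simp_all add: R_def)
  have "R \<cdot> ((eps \<boxtimes> \<I> (F T)) \<cdot> inv_mor M (F T \<otimes> F T) (F (T \<otimes>\<^bsub>C\<^esub> T)) (MU T T))
      \<in> Hom M (F (T \<otimes>\<^bsub>C\<^esub> T)) X"
    by (simp add: Hom_iff)
  then obtain m where m: "m \<in> Hom C (T \<otimes>\<^bsub>C\<^esub> T) T"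
    "eps \<cdot> Fm m = R \<cdot> ((eps \<boxtimes> \<I> (F T)) \<cdot> inv_mor M (F T \<otimes> F T) (F (T \<otimes>\<^bsub>C\<^esub> T)) (MU T T))"
    using univ[of "T \<otimes>\<^bsub>C\<^esub> T"] by (meson C.tensor_Ob T)
  have "unit_pair \<cdot> inv_mor M \<one> (F \<one>\<^bsub>C\<^esub>) IO \<in> Hom M (F \<one>\<^bsub>C\<^esub>) X"
    by (simp add: Hom_iff)
  then obtain i where i: "i \<in> Hom C \<one>\<^bsub>C\<^esub> T"
    "eps \<cdot> Fm i = unit_pair \<cdot> inv_mor M \<one> (F \<one>\<^bsub>C\<^esub>) IO"
    using univ[of "\<one>\<^bsub>C\<^esub>"] by (meson C.unit_Ob)
  have [simp]: "C.arr m" "C.src m = T \<otimes>\<^bsub>C\<^esub> T" "C.trg m = T"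
    "C.arr i" "C.src i = \<one>\<^bsub>C\<^esub>" "C.trg i = T"
    using m(1) i(1) by (auto simp: C.Hom_iff)
  have eps_m: "eps \<cdot> (Fm m \<cdot> MU T T) = R \<cdot> (eps \<boxtimes> \<I> (F T))"
    by (simp add: comp_reduce[OF m(2)])
  have eps_i: "eps \<cdot> (Fm i \<cdot> IO) = unit_pair"
    by (simp add: comp_reduce[OF i(2)])
  \<comment> \<open>Uniqueness in \<open>univ\<close>, tested after precomposing with an isomorphism
    \<open>K\<close>; below, \<open>K\<close> is built from \<open>MU\<close> and
    \<open>IO\<close>.\<close>
  have ext: "p = q" if pq: "C.arr p" "C.arr q" "C.src p = a" "C.src q = a" "C.trg p = T" "C.trg q = T"
    and K: "is_iso M k (F a) K" and eq: "eps \<cdot> (Fm p \<cdot> K) = eps \<cdot> (Fm q \<cdot> K)" for p q a k K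
  proof -
    have a: "a \<in> Ob C"
      using pq C.arr_Ob(1)[of p] by simp
    note [simp] = pq is_isoD[OF K]
    have "eps \<cdot> Fm p = eps \<cdot> Fm q"
      by (rule iso_cancel_right[OF K]) (simp_all add: eq)
    moreover have "eps \<cdot> Fm q \<in> Hom M (F a) X"
      by (simp add: Hom_iff)
    ultimately show ?thesis
      using univ[OF a] pq by (metis C.Hom_iff)
  qed
  have mult: "eps \<cdot> (Fm m \<cdot> (MU T T \<cdot> k)) = R \<cdot> ((eps \<boxtimes> \<I> (F T)) \<cdot> k)"
    if [simp]: "arr k" "trg k = F T \<otimes> F T" for k
  proof -
    have "eps \<cdot> (Fm m \<cdot> (MU T T \<cdot> k)) = (eps \<cdot> (Fm m \<cdot> MU T T)) \<cdot> k"
      by simp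
    then show ?thesis
      unfolding eps_m by simp
  qed
  \<comment> \<open>\<open>Fm m\<close> and \<open>MU T T\<close> are central, so they slide through
    the crossing, which thereby becomes that of the tensor product in the center.\<close>
  have R_m: "R \<cdot> (\<I> X \<boxtimes> (Fm m \<cdot> MU T T)) =
    act (entwine_tensor (F T) (cross (fun_ob G T)) (F T) (cross (fun_ob G T))) (R \<cdot> (eps \<boxtimes> \<I> (F T)))"
  proof -
    have "R \<cdot> (\<I> X \<boxtimes> (Fm m \<cdot> MU T T)) = (R \<cdot> (\<I> X \<boxtimes> Fm m)) \<cdot> (\<I> X \<boxtimes> MU T T)"
      by (simp add: interch)
    also have "R \<cdot> (\<I> X \<boxtimes> Fm m) = act (cross (fun_ob G (T \<otimes>\<^bsub>C\<^esub> T))) (eps \<cdot> Fm m)"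
      using act_central[OF Fm_central[of m], of eps] by (simp add: R_def)
    also have "\<dots> \<cdot> (\<I> X \<boxtimes> MU T T) =
        act (cross (center_tensor M (fun_ob G T) (fun_ob G T))) ((eps \<cdot> Fm m) \<cdot> MU T T)"
      by (rule act_central[OF MU_iso(2)]) simp_all
    also have "\<dots> = act (entwine_tensor (F T) (cross (fun_ob G T)) (F T) (cross (fun_ob G T)))
        (R \<cdot> (eps \<boxtimes> \<I> (F T)))"
      by (simp add: cross_tensor[OF G_Ob G_Ob] eps_m)
    finally show ?thesis .
  qed
  \<comment> \<open>Likewise \<open>Fm i\<close> and \<open>IO\<close> turn the crossing into that
    of the unit object.\<close>
  have R_i: "R \<cdot> (\<I> X \<boxtimes> (Fm i \<cdot> IO)) = \<rr> X"
  proof -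
    have "R \<cdot> (\<I> X \<boxtimes> (Fm i \<cdot> IO)) = (R \<cdot> (\<I> X \<boxtimes> Fm i)) \<cdot> (\<I> X \<boxtimes> IO)"
      by (simp add: interch)
    also have "R \<cdot> (\<I> X \<boxtimes> Fm i) = act (cross (fun_ob G \<one>\<^bsub>C\<^esub>)) (eps \<cdot> Fm i)"
      using act_central[OF Fm_central[of i], of eps] by (simp add: R_def)
    also have "\<dots> \<cdot> (\<I> X \<boxtimes> IO) = act (cross (center_unit M)) ((eps \<cdot> Fm i) \<cdot> IO)"
      by (rule act_central[OF IO_iso(2)]) simp_all
    also have "\<dots> = \<rr> X"
      by (simp add: eps_i cross_unit act_unit_right)
    finally show ?thesis .
  qed
  \<comment> \<open>\<open>act_act\<close> with both maps equal to \<open>eps\<close>; its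
    right-hand side is the one found in \<open>R_m\<close>.\<close>
  have R_R: "R \<cdot> (R \<boxtimes> \<I> (F T)) = (R \<cdot> (\<I> X \<boxtimes> (Fm m \<cdot> MU T T))) \<cdot> as X (F T) (F T)"
    unfolding R_m unfolding R_def by (rule act_act[OF _ _ _ _ _ _ entwines_cross[OF G_Ob]]) simp_all
  have assoc: "m \<cdot>\<^bsub>C\<^esub> (m \<boxtimes>\<^bsub>C\<^esub> \<I>\<^bsub>C\<^esub> T) = m \<cdot>\<^bsub>C\<^esub> ((\<I>\<^bsub>C\<^esub> T \<boxtimes>\<^bsub>C\<^esub> m) \<cdot>\<^bsub>C\<^esub> assoc C T T T)"
  proof (rule ext)
    let ?K = "MU (T \<otimes>\<^bsub>C\<^esub> T) T \<cdot> (MU T T \<boxtimes> \<I> (F T))"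
    show "is_iso M ((F T \<otimes> F T) \<otimes> F T) (F ((T \<otimes>\<^bsub>C\<^esub> T) \<otimes>\<^bsub>C\<^esub> T)) ?K"
      by (rule is_iso_comp[OF is_iso_tensor[OF MU_iso(1) is_iso_ident] MU_iso(1)]) simp_all
    have "eps \<cdot> (Fm (m \<cdot>\<^bsub>C\<^esub> (m \<boxtimes>\<^bsub>C\<^esub> \<I>\<^bsub>C\<^esub> T)) \<cdot> ?K) =
        eps \<cdot> (Fm m \<cdot> ((Fm (m \<boxtimes>\<^bsub>C\<^esub> \<I>\<^bsub>C\<^esub> T) \<cdot> MU (T \<otimes>\<^bsub>C\<^esub> T) T) \<cdot> (MU T T \<boxtimes> \<I> (F T))))"
      by (simp add: Fm_comp)
    also have "Fm (m \<boxtimes>\<^bsub>C\<^esub> \<I>\<^bsub>C\<^esub> T) \<cdot> MU (T \<otimes>\<^bsub>C\<^esub> T) T = MU T T \<cdot> (Fm m \<boxtimes> \<I> (F T))"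
      using MU_nat[of m "\<I>\<^bsub>C\<^esub> T"] by (simp add: Fm_ident)
    also have "eps \<cdot> (Fm m \<cdot> ((MU T T \<cdot> (Fm m \<boxtimes> \<I> (F T))) \<cdot> (MU T T \<boxtimes> \<I> (F T)))) =
        R \<cdot> ((eps \<cdot> (Fm m \<cdot> MU T T)) \<boxtimes> \<I> (F T))"
      by (simp add: mult interch)
    also have "\<dots> = (R \<cdot> (R \<boxtimes> \<I> (F T))) \<cdot> ((eps \<boxtimes> \<I> (F T)) \<boxtimes> \<I> (F T))"
      by (simp add: eps_m interch)
    also have "\<dots> = R \<cdot> ((\<I> X \<boxtimes> (Fm m \<cdot> MU T T)) \<cdot> ((eps \<boxtimes> (\<I> (F T) \<boxtimes> \<I> (F T))) \<cdot>
        as (F T) (F T) (F T)))"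
      \<comment> \<open>Here the bracketing changes; the rest folds \<open>eps\<close> and
        \<open>m\<close> back together.\<close>
      unfolding R_R using assoc_nat[of eps "\<I> (F T)" "\<I> (F T)" X "F T" "F T"] by simp
    also have "\<dots> = R \<cdot> ((eps \<boxtimes> \<I> (F T)) \<cdot> ((\<I> (F T) \<boxtimes> Fm m) \<cdot> ((\<I> (F T) \<boxtimes> MU T T) \<cdot>
        as (F T) (F T) (F T))))"
      by (simp add: interch)
    also have "\<dots> = eps \<cdot> (Fm m \<cdot> ((MU T T \<cdot> (\<I> (F T) \<boxtimes> Fm m)) \<cdot> ((\<I> (F T) \<boxtimes> MU T T) \<cdot>
        as (F T) (F T) (F T))))"
      by (simp add: mult)
    also have "MU T T \<cdot> (\<I> (F T) \<boxtimes> Fm m) = Fm (\<I>\<^bsub>C\<^esub> T \<boxtimes>\<^bsub>C\<^esub> m) \<cdot> MU T (T \<otimes>\<^bsub>C\<^esub> T)"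
      using MU_nat[of "\<I>\<^bsub>C\<^esub> T" m] by (simp add: Fm_ident)
    also have "eps \<cdot> (Fm m \<cdot> ((Fm (\<I>\<^bsub>C\<^esub> T \<boxtimes>\<^bsub>C\<^esub> m) \<cdot> MU T (T \<otimes>\<^bsub>C\<^esub> T)) \<cdot>
          ((\<I> (F T) \<boxtimes> MU T T) \<cdot> as (F T) (F T) (F T)))) =
        eps \<cdot> (Fm m \<cdot> (Fm (\<I>\<^bsub>C\<^esub> T \<boxtimes>\<^bsub>C\<^esub> m) \<cdot> (Fm (assoc C T T T) \<cdot> ?K)))"
      by (simp add: MU_assoc)
    also have "\<dots> = eps \<cdot> (Fm (m \<cdot>\<^bsub>C\<^esub> ((\<I>\<^bsub>C\<^esub> T \<boxtimes>\<^bsub>C\<^esub> m) \<cdot>\<^bsub>C\<^esub> assoc C T T T)) \<cdot> ?K)"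
      by (simp add: Fm_comp)
    finally show "eps \<cdot> (Fm (m \<cdot>\<^bsub>C\<^esub> (m \<boxtimes>\<^bsub>C\<^esub> \<I>\<^bsub>C\<^esub> T)) \<cdot> ?K) =
        eps \<cdot> (Fm (m \<cdot>\<^bsub>C\<^esub> ((\<I>\<^bsub>C\<^esub> T \<boxtimes>\<^bsub>C\<^esub> m) \<cdot>\<^bsub>C\<^esub> assoc C T T T)) \<cdot> ?K)" .
  qed simp_all
  have left: "m \<cdot>\<^bsub>C\<^esub> (i \<boxtimes>\<^bsub>C\<^esub> \<I>\<^bsub>C\<^esub> T) = \<ll>\<^bsub>C\<^esub> T"
  proof (rule ext)
    let ?K = "MU \<one>\<^bsub>C\<^esub> T \<cdot> (IO \<boxtimes> \<I> (F T))"
    show "is_iso M (\<one> \<otimes> F T) (F (\<one>\<^bsub>C\<^esub> \<otimes>\<^bsub>C\<^esub> T)) ?K"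
      by (rule is_iso_comp[OF is_iso_tensor[OF IO_iso(1) is_iso_ident] MU_iso(1)]) simp_all
    have "eps \<cdot> (Fm (m \<cdot>\<^bsub>C\<^esub> (i \<boxtimes>\<^bsub>C\<^esub> \<I>\<^bsub>C\<^esub> T)) \<cdot> ?K) =
        eps \<cdot> (Fm m \<cdot> ((Fm (i \<boxtimes>\<^bsub>C\<^esub> \<I>\<^bsub>C\<^esub> T) \<cdot> MU \<one>\<^bsub>C\<^esub> T) \<cdot> (IO \<boxtimes> \<I> (F T))))"
      by (simp add: Fm_comp)
    also have "Fm (i \<boxtimes>\<^bsub>C\<^esub> \<I>\<^bsub>C\<^esub> T) \<cdot> MU \<one>\<^bsub>C\<^esub> T = MU T T \<cdot> (Fm i \<boxtimes> \<I> (F T))"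
      using MU_nat[of i "\<I>\<^bsub>C\<^esub> T"] by (simp add: Fm_ident)
    also have "eps \<cdot> (Fm m \<cdot> ((MU T T \<cdot> (Fm i \<boxtimes> \<I> (F T))) \<cdot> (IO \<boxtimes> \<I> (F T)))) =
        R \<cdot> ((eps \<cdot> (Fm i \<cdot> IO)) \<boxtimes> \<I> (F T))"
      by (simp add: mult interch)
    also have "\<dots> = eps \<cdot> \<ll> (F T)"
      \<comment> \<open>The unit is the outer argument here, so \<open>act_unit_left\<close>
        applies.\<close>
      unfolding eps_i unfolding R_def by (rule act_unit_left[OF entwines_cross[OF G_Ob]]) simp_all
    also have "\<dots> = eps \<cdot> (Fm (\<ll>\<^bsub>C\<^esub> T) \<cdot> ?K)"
      by (simp add: MU_unit)
    finally show "eps \<cdot> (Fm (m \<cdot>\<^bsub>C\<^esub> (i \<boxtimes>\<^bsub>C\<^esub> \<I>\<^bsub>C\<^esub> T)) \<cdot> ?K) = eps \<cdot> (Fm (\<ll>\<^bsub>C\<^esub> T) \<cdot> ?K)" .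
  qed simp_all
  have right: "m \<cdot>\<^bsub>C\<^esub> (\<I>\<^bsub>C\<^esub> T \<boxtimes>\<^bsub>C\<^esub> i) = \<rr>\<^bsub>C\<^esub> T"
  proof (rule ext)
    let ?K = "MU T \<one>\<^bsub>C\<^esub> \<cdot> (\<I> (F T) \<boxtimes> IO)"
    show "is_iso M (F T \<otimes> \<one>) (F (T \<otimes>\<^bsub>C\<^esub> \<one>\<^bsub>C\<^esub>)) ?K"
      by (rule is_iso_comp[OF is_iso_tensor[OF is_iso_ident IO_iso(1)] MU_iso(1)]) simp_all
    have "eps \<cdot> (Fm (m \<cdot>\<^bsub>C\<^esub> (\<I>\<^bsub>C\<^esub> T \<boxtimes>\<^bsub>C\<^esub> i)) \<cdot> ?K) =
        eps \<cdot> (Fm m \<cdot> ((Fm (\<I>\<^bsub>C\<^esub> T \<boxtimes>\<^bsub>C\<^esub> i) \<cdot> MU T \<one>\<^bsub>C\<^esub>) \<cdot> (\<I> (F T) \<boxtimes> IO)))"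
      by (simp add: Fm_comp)
    also have "Fm (\<I>\<^bsub>C\<^esub> T \<boxtimes>\<^bsub>C\<^esub> i) \<cdot> MU T \<one>\<^bsub>C\<^esub> = MU T T \<cdot> (\<I> (F T) \<boxtimes> Fm i)"
      using MU_nat[of "\<I>\<^bsub>C\<^esub> T" i] by (simp add: Fm_ident)
    also have "eps \<cdot> (Fm m \<cdot> ((MU T T \<cdot> (\<I> (F T) \<boxtimes> Fm i)) \<cdot> (\<I> (F T) \<boxtimes> IO))) =
        (R \<cdot> (\<I> X \<boxtimes> (Fm i \<cdot> IO))) \<cdot> (eps \<boxtimes> \<I> \<one>)"
      by (simp add: mult interch)
    also have "\<dots> = eps \<cdot> \<rr> (F T)"
      \<comment> \<open>The unit is the nested argument here, which is the case of
        \<open>act_unit_right\<close> contained in \<open>R_i\<close>.\<close>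
      unfolding R_i by (simp add: runit_nat)
    also have "\<dots> = eps \<cdot> (Fm (\<rr>\<^bsub>C\<^esub> T) \<cdot> ?K)"
      by (simp add: MU_unit)
    finally show "eps \<cdot> (Fm (m \<cdot>\<^bsub>C\<^esub> (\<I>\<^bsub>C\<^esub> T \<boxtimes>\<^bsub>C\<^esub> i)) \<cdot> ?K) = eps \<cdot> (Fm (\<rr>\<^bsub>C\<^esub> T) \<cdot> ?K)" .
  qed simp_all
  have "algebra_object C T m i"
    using m(1) i(1) assoc left right by (simp add: algebra_object_def)
  then show ?thesis
    by blast
qed

end

theorem proposition5p5:
  fixes C :: "('c, 'k) pivotal_category"
    and M :: "('o, 'm) pivotal_category"
    and PhiZ :: "('c, 'k, 'o \<times> ('o \<Rightarrow> 'm),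
                  ('o \<times> ('o \<Rightarrow> 'm)) \<times> 'm \<times> ('o \<times> ('o \<Rightarrow> 'm))) tensor_functor"
    and Tr :: "('o, 'm, 'c, 'k) cat_functor"
  assumes "pivotal_category C" and "pivotal_category M"
    and "pivotal_functor C (center M) PhiZ"
    and "right_adjoint C M (comp_functor forget PhiZ) Tr"
    and "algebra_object M A mA iA" and "algebra_object M B mB iB"
  shows "\<exists>m i. algebra_object C (fun_ob Tr (A \<otimes>\<^bsub>M\<^esub> B)) m i"
proof -
  interpret C: pivotal_category C by fact
  interpret M: pivotal_category M by fact
  interpret central_functor C M A B mA iA mB iB PhiZ
    using assms(3,5,6) by unfold_locales (auto simp: pivotal_functor_def)
  have X: "A \<otimes>\<^bsub>M\<^esub> B \<in> Ob M"
    by simp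
  note T = right_adjoint_universal[OF C.category_axioms M.category_axioms assms(4) X]
  show ?thesis
    using T algebra_of_universal[of "fun_ob Tr (A \<otimes>\<^bsub>M\<^esub> B)"]
    \<comment> \<open>Unfolding the composite with \<open>forget\<close> turns its object and
      morphism parts into \<open>F\<close> and \<open>Fm\<close>, so the counit has the universal
      property required.\<close>
    by (force simp: comp_functor_def forget_def case_prod_beta)
qed

end
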